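(* In the roommates model (and hence also the marriage model), if each agent's preference list consists of a single tie, then for any $c>\frac{1}{3}$ a $cn$-stable matching exists and can be found in $O(\sqrt{n}\,m)$ time, where $n$ is the number of agents and $m$ the number of edges of the acceptability graph.
   Context: Roommates model: a set $N$ of $n$ agents; each agent has a subset of $N\setminus\{i\}$ of acceptable agents (acceptability mutual), forming the acceptability graph with $m$ edges. A preference list is a single tie if the agent is indifferent among all its acceptable agents (and strictly prefers being matched to any of them to being unmatched). A matching is a set of disjoint edges of the acceptability graph; $M(i)$ is the partner of $i$ (possibly none). Agent $i$ prefers $M'$ to $M$, written $M'(i)\succ_i M(i)$, if $M'(i)$ is strictly better than $M(i)$ for $i$. For a real number $k$, a matching $M$ is $k$-stable if there is no matching $M'$ with $|\{i\in N: M'(i)\succ_i M(i)\}|\ge k$. *)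

theory Defs
  imports Complex_Main
begin

section \<open>The roommates model\<close>

text \<open>
  The preference list of an agent \<open>i\<close> is a weak order (ties allowed) on its acceptable agents;
  \<open>weakly_prefers I i x y\<close> means that \<open>i\<close> finds \<open>x\<close> at least as good as \<open>y\<close>.
\<close>

record 'a roommates_instance =
  agents :: "'a set"
  acceptable :: "'a \<Rightarrow> 'a set"
  weakly_prefers :: "'a \<Rightarrow> 'a \<Rightarrow> 'a \<Rightarrow> bool"

definition roommates :: "'a roommates_instance \<Rightarrow> bool" where
  "roommates I \<longleftrightarrow>
     finite (agents I) \<and> agents I \<noteq> {} \<and>
     (\<forall>i\<in>agents I. acceptable I i \<subseteq> agents I - {i}) \<and>
     (\<forall>i\<in>agents I. \<forall>j\<in>agents I. j \<in> acceptable I i \<longleftrightarrow> i \<in> acceptable I j) \<and>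
     (\<forall>i\<in>agents I. reflp_on (acceptable I i) (weakly_prefers I i) \<and>
                   transp_on (acceptable I i) (weakly_prefers I i) \<and>
                   totalp_on (acceptable I i) (weakly_prefers I i))"

definition marriage :: "'a roommates_instance \<Rightarrow> bool" where
  "marriage I \<longleftrightarrow>
     roommates I \<and>
     (\<exists>U W. U \<union> W = agents I \<and> U \<inter> W = {} \<and>
            (\<forall>i\<in>U. acceptable I i \<subseteq> W) \<and> (\<forall>i\<in>W. acceptable I i \<subseteq> U))"

definition single_ties :: "'a roommates_instance \<Rightarrow> bool" where
  "single_ties I \<longleftrightarrow>
     (\<forall>i\<in>agents I. \<forall>x\<in>acceptable I i. \<forall>y\<in>acceptable I i. weakly_prefers I i x y)"

abbreviation num_agents :: "'a roommates_instance \<Rightarrow> nat" where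
  "num_agents I \<equiv> card (agents I)"

definition edges :: "'a roommates_instance \<Rightarrow> 'a set set" where
  "edges I = {{i, j} | i j. i \<in> agents I \<and> j \<in> acceptable I i}"

abbreviation num_edges :: "'a roommates_instance \<Rightarrow> nat" where
  "num_edges I \<equiv> card (edges I)"

definition matching :: "'a roommates_instance \<Rightarrow> 'a set set \<Rightarrow> bool" where
  "matching I M \<longleftrightarrow> M \<subseteq> edges I \<and> pairwise disjnt M"

definition partner :: "'a set set \<Rightarrow> 'a \<Rightarrow> 'a option" where
  "partner M i = (if \<exists>j. {i, j} \<in> M then Some (THE j. {i, j} \<in> M) else None)"

text \<open>
  Strict preference of an agent between outcomes, where \<open>None\<close> stands for being unmatched.
  Every acceptable partner is strictly better than being unmatched.
\<close>

fun prefers :: "'a roommates_instance \<Rightarrow> 'a \<Rightarrow> 'a option \<Rightarrow> 'a option \<Rightarrow> bool" where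
  "prefers I i (Some x) (Some y) \<longleftrightarrow>
     x \<in> acceptable I i \<and> y \<in> acceptable I i \<and> \<not> weakly_prefers I i y x"
| "prefers I i (Some x) None \<longleftrightarrow> x \<in> acceptable I i"
| "prefers I i None _ \<longleftrightarrow> False"

definition k_stable :: "'a roommates_instance \<Rightarrow> real \<Rightarrow> 'a set set \<Rightarrow> bool" where
  "k_stable I k M \<longleftrightarrow>
     matching I M \<and>
     \<not> (\<exists>M'. matching I M' \<and>
             real (card {i \<in> agents I. prefers I i (partner M' i) (partner M i)}) \<ge> k)"


section \<open>Random access machines\<close>

text \<open>
  The random access machine of Cook and Reckhow (1973) with uniform cost, with registers holding
  natural numbers and truncated subtraction. There is no multiplication. The machine halts when
  the program counter leaves the program; reading past the end of the input yields 0.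
\<close>

datatype instr =
    Const nat nat       \<comment> \<open>\<open>X_i := c\<close>\<close>
  | Add nat nat nat     \<comment> \<open>\<open>X_i := X_j + X_k\<close>\<close>
  | Sub nat nat nat     \<comment> \<open>\<open>X_i := X_j - X_k\<close>\<close>
  | Load nat nat        \<comment> \<open>\<open>X_i := X_(X_j)\<close>\<close>
  | Store nat nat       \<comment> \<open>\<open>X_(X_i) := X_j\<close>\<close>
  | Jump_Pos nat nat    \<comment> \<open>if \<open>X_j > 0\<close> then go to \<open>l\<close>\<close>
  | Read nat
  | Print nat

record config =
  pc :: nat
  reg :: "nat \<Rightarrow> nat"
  inp :: "nat list"
  outp :: "nat list"

fun exec :: "instr \<Rightarrow> config \<Rightarrow> config" where
  "exec (Const i c) s = s\<lparr>pc := pc s + 1, reg := (reg s)(i := c)\<rparr>"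
| "exec (Add i j k) s = s\<lparr>pc := pc s + 1, reg := (reg s)(i := reg s j + reg s k)\<rparr>"
| "exec (Sub i j k) s = s\<lparr>pc := pc s + 1, reg := (reg s)(i := reg s j - reg s k)\<rparr>"
| "exec (Load i j) s = s\<lparr>pc := pc s + 1, reg := (reg s)(i := reg s (reg s j))\<rparr>"
| "exec (Store i j) s = s\<lparr>pc := pc s + 1, reg := (reg s)(reg s i := reg s j)\<rparr>"
| "exec (Jump_Pos j l) s = s\<lparr>pc := (if reg s j > 0 then l else pc s + 1)\<rparr>"
| "exec (Read i) s =
     s\<lparr>pc := pc s + 1, reg := (reg s)(i := (case inp s of [] \<Rightarrow> 0 | x # _ \<Rightarrow> x)),
       inp := tl (inp s)\<rparr>"
| "exec (Print i) s = s\<lparr>pc := pc s + 1, outp := outp s @ [reg s i]\<rparr>"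

definition halted :: "instr list \<Rightarrow> config \<Rightarrow> bool" where
  "halted P s \<longleftrightarrow> pc s \<ge> length P"

definition step :: "instr list \<Rightarrow> config \<Rightarrow> config" where
  "step P s = (if halted P s then s else exec (P ! pc s) s)"

definition config_after :: "instr list \<Rightarrow> nat list \<Rightarrow> nat \<Rightarrow> config" where
  "config_after P xs t = (step P ^^ t) \<lparr>pc = 0, reg = (\<lambda>_. 0), inp = xs, outp = []\<rparr>"

text \<open>
  On input \<open>xs\<close>, the program halts with output \<open>ys\<close> after at most \<open>T\<close> steps, and no register ever
  holds a number exceeding \<open>w\<close>.
\<close>

definition computes_within ::
    "instr list \<Rightarrow> nat list \<Rightarrow> real \<Rightarrow> nat \<Rightarrow> nat list \<Rightarrow> bool" where
  "computes_within P xs T w ys \<longleftrightarrow>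
     (\<exists>t. real t \<le> T \<and> halted P (config_after P xs t) \<and> outp (config_after P xs t) = ys) \<and>
     (\<forall>t r. reg (config_after P xs t) r \<le> w)"


section \<open>Finding matchings on a random access machine\<close>

text \<open>\<open>es\<close> lists every edge in \<open>E\<close> exactly once, in any order and with either orientation.\<close>

definition edge_listing :: "(nat \<times> nat) list \<Rightarrow> nat set set \<Rightarrow> bool" where
  "edge_listing es E \<longleftrightarrow> (\<lambda>(u, v). {u, v}) ` set es = E \<and> length es = card E"

definition flatten :: "(nat \<times> nat) list \<Rightarrow> nat list" where
  "flatten es = concat (map (\<lambda>(u, v). [u, v]) es)"

text \<open>
  The agents of the input are \<open>0, ..., n - 1\<close>. The acceptability graph is given by an edge list
  preceded by \<open>n\<close> and \<open>m\<close>. (Adjacency lists indexed by the agents would have size at least \<open>n\<close>,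
  which is not bounded by a multiple of \<open>sqrt n * m\<close> if most agents are isolated.)
  Preferences are not part of the encoding, since single ties are determined by the
  acceptability graph.
\<close>

definition encodes_instance :: "nat list \<Rightarrow> nat roommates_instance \<Rightarrow> bool" where
  "encodes_instance xs I \<longleftrightarrow>
     agents I = {..<num_agents I} \<and>
     (\<exists>es. edge_listing es (edges I) \<and> xs = num_agents I # num_edges I # flatten es)"

definition encodes_matching :: "nat list \<Rightarrow> nat set set \<Rightarrow> bool" where
  "encodes_matching ys M \<longleftrightarrow> (\<exists>es. edge_listing es M \<and> ys = flatten es)"

text \<open>
  A single program finds, for every instance in the class \<open>K\<close>, a solution (as described by \<open>sol\<close>)
  in time \<open>O(f n m)\<close> using words of \<open>O(log n)\<close> bits. The constants are uniform over all instances.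
  The maximum with 1 only matters if \<open>f n m < 1\<close>, which for \<open>f n m = sqrt n * m\<close> means \<open>m = 0\<close>:
  no machine can recognise a graph without edges in zero steps.
\<close>

definition findable_in_time ::
    "(nat roommates_instance \<Rightarrow> bool) \<Rightarrow> (nat roommates_instance \<Rightarrow> nat set set \<Rightarrow> bool) \<Rightarrow>
     (nat \<Rightarrow> nat \<Rightarrow> real) \<Rightarrow> bool" where
  "findable_in_time K sol f \<longleftrightarrow>
     (\<exists>P C d. \<forall>I xs. K I \<and> encodes_instance xs I \<longrightarrow>
        (\<exists>M ys. sol I M \<and> encodes_matching ys M \<and>
           computes_within P xs (C * max 1 (f (num_agents I) (num_edges I)))
             ((num_agents I + 2) ^ d) ys))"

end

theory Submission
  imports Defs
begin

text \<open>
  With single ties an agent improves iff it is unmatched in \<open>M\<close> and matched in \<open>M'\<close>. If \<open>M\<close> has no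
  augmenting path of length 1 or 3, then the triples formed by an improving agent, its new partner, and
  the old partner of that partner are disjoint, so at most \<open>n / 3\<close> agents improve. Hence a maximum
  matching is not needed: it suffices to build a greedy maximal matching and then to inspect every
  matched edge once, replacing it by two edges if its endpoints have distinct unmatched neighbours. This
  takes time \<open>O(m)\<close>. The algorithm is written in a small while language with named variables and
  arrays, for which a weakest precondition calculus that counts steps is sound with respect to the
  compiled machine program.
\<close>

section \<open>Matchings without short augmenting paths\<close>

text \<open>The time bound must also hold when \<open>n\<close> is far larger than \<open>m\<close>,
  so nothing may be initialised or scanned agent by agent: every loop runs over the input edges,
  over the arcs or along one adjacency list, and the arrays rely on registers being 0 initially.
  Linear time is within the required bound because \<open>n \<ge> 1\<close> gives
  \<open>m \<le> sqrt n * m\<close>. A single pass suffices because an augmentation never unmatches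
  a vertex. Maximality, and the fact that an inspected edge admits no augmentation, therefore
  survive all later changes. The strict inequality \<open>c > 1 / 3\<close> is what the counting
  needs: \<open>k_stable\<close> already fails when exactly \<open>k\<close> agents improve, and
  \<open>n / 3\<close> improving agents cannot be excluded by disjointness of triples. Existence is
  proved separately with a maximum matching, because the program only treats agents that are the
  numbers below \<open>n\<close>, whereas the theorem speaks of agents of an arbitrary type.\<close>

lemma edges_iff:
  assumes "roommates I"
  shows "{i, j} \<in> edges I \<longleftrightarrow> i \<in> agents I \<and> j \<in> acceptable I i"
proof
  assume "{i, j} \<in> edges I"
  then obtain x y where xy: "{i, j} = {x, y}" "x \<in> agents I" "y \<in> acceptable I x"
    unfolding edges_def by blast
  moreover have "y \<in> agents I"
    using assms xy unfolding roommates_def by blast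
  ultimately show "i \<in> agents I \<and> j \<in> acceptable I i"
    using assms unfolding roommates_def doubleton_eq_iff by blast
qed (auto simp: edges_def)

lemma edge_endpoints:
  assumes "roommates I" and "{i, j} \<in> edges I"
  shows "i \<in> agents I" "j \<in> agents I" "i \<noteq> j"
  using assms edges_iff[OF assms(1), of i j] unfolding roommates_def by auto

lemma matching_partner_unique:
  assumes "matching I M" and "{i, j} \<in> M" and "{i, l} \<in> M"
  shows "j = l"
proof -
  have "{i, j} = {i, l}"
    using assms pairwiseD[of disjnt M "{i, j}" "{i, l}"]
    unfolding matching_def by (auto simp: disjnt_def)
  then show ?thesis
    by (auto simp: doubleton_eq_iff)
qed

lemma partner_eq_Some_iff:
  assumes "matching I M"
  shows "partner M i = Some j \<longleftrightarrow> {i, j} \<in> M"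
proof
  assume "partner M i = Some j"
  then obtain l where l: "{i, l} \<in> M" and j: "j = (THE j. {i, j} \<in> M)"
    by (auto simp: partner_def split: if_splits)
  have "(THE j. {i, j} \<in> M) = l"
    using l matching_partner_unique[OF assms] by (intro the_equality) auto
  with l j show "{i, j} \<in> M" by simp
next
  assume *: "{i, j} \<in> M"
  have "(THE j. {i, j} \<in> M) = j"
    using * matching_partner_unique[OF assms] by (intro the_equality) auto
  with * show "partner M i = Some j"
    by (auto simp: partner_def)
qed

lemma matched_iff:
  assumes "roommates I" and "matching I M"
  shows "i \<in> \<Union>M \<longleftrightarrow> (\<exists>j. {i, j} \<in> M)"
proof
  assume "i \<in> \<Union>M"
  then obtain e where e: "e \<in> M" "i \<in> e" by blast
  then have "e \<in> edges I"
    using assms unfolding matching_def by blast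
  then obtain x y where "e = {x, y}"
    unfolding edges_def by blast
  with e show "\<exists>j. {i, j} \<in> M"
    by (auto simp: insert_commute)
qed auto

lemma partner_eq_None_iff:
  assumes "roommates I" and "matching I M"
  shows "partner M i = None \<longleftrightarrow> i \<notin> \<Union>M"
  using matched_iff[OF assms, of i] by (auto simp: partner_def)

text \<open>
  Every improving agent \<open>i\<close> claims itself, its new partner \<open>y\<close>, and the old partner of \<open>y\<close>; a common
  element of two such triples would yield an augmenting path of length 3.
\<close>

lemma k_stable_if_no_short_augmenting_path:
  assumes I: "roommates I" and ties: "single_ties I" and M: "matching I M"
    and maximal: "\<And>i j. {i, j} \<in> edges I \<Longrightarrow> i \<in> \<Union>M \<or> j \<in> \<Union>M"
    and no_path: "\<And>u v a b. {u, v} \<in> M \<Longrightarrow> {a, u} \<in> edges I \<Longrightarrow> {b, v} \<in> edges I \<Longrightarrow>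
       a \<notin> \<Union>M \<Longrightarrow> b \<notin> \<Union>M \<Longrightarrow> a = b"
    and k: "k > real (num_agents I) / 3"
  shows "k_stable I k M"
  unfolding k_stable_def
proof (intro conjI notI)
  assume "\<exists>M'. matching I M' \<and>
             k \<le> real (card {i \<in> agents I. prefers I i (partner M' i) (partner M i)})"
  then obtain M' where M': "matching I M'"
    and large: "k \<le> real (card {i \<in> agents I. prefers I i (partner M' i) (partner M i)})"
    by blast
  define D where "D = {i \<in> agents I. prefers I i (partner M' i) (partner M i)}"
  have edge: "{i, j} \<in> edges I" if "{i, j} \<in> M \<or> {i, j} \<in> M'" for i j
    using that M M' unfolding matching_def by blast
  have fin: "finite (agents I)"
    using I unfolding roommates_def by blast
  have D: "i \<notin> \<Union>M \<and> (\<exists>y. {i, y} \<in> M')" if "i \<in> D" for i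
  proof -
    have pr: "prefers I i (partner M' i) (partner M i)" and i: "i \<in> agents I"
      using that by (auto simp: D_def)
    then obtain y where y: "partner M' i = Some y"
      by (cases "partner M' i") auto
    have "partner M i = None"
    proof (cases "partner M i")
      case (Some x)
      with pr y ties i show ?thesis
        by (auto simp: single_ties_def)
    qed
    with y show ?thesis
      using partner_eq_None_iff[OF I M] partner_eq_Some_iff[OF M'] by auto
  qed
  define y where "y i = (SOME j. {i, j} \<in> M')" for i
  have y: "{i, y i} \<in> M'" if "i \<in> D" for i
    using D[OF that] someI_ex[of "\<lambda>j. {i, j} \<in> M'"] unfolding y_def by blast
  define z where "z i = (SOME j. {y i, j} \<in> M)" for i
  have z: "{y i, z i} \<in> M" if "i \<in> D" for i
  proof -
    have "y i \<in> \<Union>M"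
      using maximal[OF edge] y[OF that] D[OF that] by blast
    then show ?thesis
      using matched_iff[OF I M] someI_ex[of "\<lambda>j. {y i, j} \<in> M"] unfolding z_def by blast
  qed
  have y_inj: "i = j" if "i \<in> D" "j \<in> D" "y i = y j" for i j
    using matching_partner_unique[OF M', of "y i" i j] y[OF that(1)] y[OF that(2)] that(3)
    by (simp add: insert_commute)
  have z_inj: "i = j" if "i \<in> D" "j \<in> D" "z i = z j" for i j
    using matching_partner_unique[OF M, of "z i" "y i" "y j"] z[OF that(1)] z[OF that(2)] that y_inj
    by (simp add: insert_commute)
  \<comment> \<open>If \<open>y i = z j\<close>, then \<open>y j\<close> and \<open>y i\<close> are
    partners in \<open>M\<close>, so \<open>i, y i, y j, j\<close> is an augmenting path unless
    \<open>i = j\<close>; and \<open>i = j\<close> would make \<open>y i\<close> its own partner.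
    The injectivity of \<open>y\<close> and \<open>z\<close> needs only that \<open>M'\<close> and
    \<open>M\<close> are matchings.\<close>
  have yz: "y i \<noteq> z j" if "i \<in> D" "j \<in> D" for i j
  proof
    assume eq: "y i = z j"
    have ij: "i = j"
      using no_path[of "y i" "y j" i j] z[OF that(2)] eq edge y[OF that(1)] y[OF that(2)] D that
      by (simp add: insert_commute)
    show False
      using edge_endpoints(3)[OF I edge, of "y j" "z j"] z[OF that(2)] eq ij by simp
  qed
  have free: "y i \<noteq> j \<and> z i \<noteq> j" if "i \<in> D" "j \<in> D" for i j
    using z[OF that(1)] D[OF that(2)] by blast
  have sub: "D \<union> (y ` D \<union> z ` D) \<subseteq> agents I"
    using z edge edge_endpoints[OF I] D_def by blast
  have finD: "finite D"
    using fin by (simp add: D_def)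
  have disj: "D \<inter> (y ` D \<union> z ` D) = {}" "y ` D \<inter> z ` D = {}"
    using free yz by blast+
  have "card (D \<union> (y ` D \<union> z ` D)) = card D + (card (y ` D) + card (z ` D))"
    using disj finD by (simp add: card_Un_disjoint)
  also have "\<dots> = 3 * card D"
    using y_inj z_inj by (simp add: card_image inj_on_def)
  finally have "3 * card D \<le> num_agents I"
    using card_mono[OF fin sub] by simp
  then show False
    using large k by (simp add: D_def)
qed (rule M)

section \<open>Existence from a matching of maximum cardinality\<close>

lemma finite_edges:
  assumes "roommates I"
  shows "finite (edges I)" and "num_edges I \<le> num_agents I * num_agents I"
proof -
  have sub: "edges I \<subseteq> (\<lambda>(i, j). {i, j}) ` (agents I \<times> agents I)"
    using assms unfolding edges_def roommates_def by fast
  have fin: "finite (agents I \<times> agents I)"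
    using assms unfolding roommates_def by blast
  show "finite (edges I)"
    using finite_surj[OF fin sub] .
  show "num_edges I \<le> num_agents I * num_agents I"
    using surj_card_le[OF fin sub] by (simp add: card_cartesian_product)
qed

lemma matching_insert:
  assumes "roommates I" and "matching I M" and "{i, j} \<in> edges I" and "i \<notin> \<Union>M" and "j \<notin> \<Union>M"
  shows "matching I (insert {i, j} M)"
  using assms unfolding matching_def pairwise_insert by (auto simp: disjnt_def)

lemma matching_subset: "matching I M \<Longrightarrow> M' \<subseteq> M \<Longrightarrow> matching I M'"
  unfolding matching_def by (auto intro: pairwise_subset)

text \<open>In a matching of maximum cardinality, flipping an augmenting path of length 1 or 3 would
  yield a larger one. Finiteness of the edge set bounds all cardinalities, so a maximum
  exists.\<close>

lemma k_stable_exists: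
  assumes I: "roommates I" and "single_ties I" and "k > real (num_agents I) / 3"
  shows "\<exists>M. k_stable I k M"
proof -
  have fin: "finite (edges I)"
    using finite_edges(1)[OF I] .
  have "card M < Suc (num_edges I)" if "matching I M" for M
    using that card_mono[OF fin] unfolding matching_def by (simp add: less_Suc_eq_le)
  moreover have "matching I {}"
    by (simp add: matching_def)
  ultimately obtain M where M: "matching I M"
    and max: "\<And>M'. matching I M' \<Longrightarrow> card M' \<le> card M"
    using ex_has_greatest_nat[of "matching I" "{}" card "Suc (num_edges I)"] by blast
  have finM: "finite M"
    using M finite_subset[OF _ fin] unfolding matching_def by blast
  have "i \<in> \<Union>M \<or> j \<in> \<Union>M" if "{i, j} \<in> edges I" for i j
  proof (rule ccontr)
    assume *: "\<not> (i \<in> \<Union>M \<or> j \<in> \<Union>M)"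
    then have "{i, j} \<notin> M" by blast
    then have "card (insert {i, j} M) = Suc (card M)"
      using finM by simp
    with max[OF matching_insert[OF I M that]] * show False by auto
  qed
  moreover have "a = b"
    if uv: "{u, v} \<in> M" and a: "{a, u} \<in> edges I" "a \<notin> \<Union>M" and b: "{b, v} \<in> edges I" "b \<notin> \<Union>M"
    for u v a b
  proof (rule ccontr)
    assume "a \<noteq> b"
    \<comment> \<open>Dropping the middle edge frees \<open>u\<close> and \<open>v\<close>; the two
      outer edges are then inserted one after the other.\<close>
    define N where "N = M - {{u, v}}"
    have N: "matching I N"
      using matching_subset[OF M] unfolding N_def by blast
    have "disjnt e {u, v}" if "e \<in> N" for e
      using that uv M pairwiseD[of disjnt M e "{u, v}"] unfolding N_def matching_def by simp
    then have uvN: "u \<notin> \<Union>N" "v \<notin> \<Union>N"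
      by (auto simp: disjnt_def)
    have abN: "a \<notin> \<Union>N" "b \<notin> \<Union>N"
      using a(2) b(2) unfolding N_def by blast+
    have "u \<noteq> v"
      using edge_endpoints(3)[OF I, of u v] uv M unfolding matching_def by blast
    have "u \<noteq> b" "v \<noteq> a"
      using uv a b by auto
    have N': "matching I (insert {a, u} N)"
      using matching_insert[OF I N a(1)] abN uvN by blast
    have "matching I (insert {b, v} (insert {a, u} N))"
      using matching_insert[OF I N' b(1)] abN uvN \<open>a \<noteq> b\<close> \<open>u \<noteq> v\<close> \<open>u \<noteq> b\<close> \<open>v \<noteq> a\<close> by auto
    moreover have "card (insert {b, v} (insert {a, u} N)) = Suc (Suc (card N))"
    proof -
      have "{a, u} \<notin> N" "{b, v} \<notin> insert {a, u} N"
        using abN \<open>a \<noteq> b\<close> \<open>u \<noteq> b\<close> by blast+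
      then show ?thesis
        using finM by (simp add: N_def)
    qed
    moreover have "card M = Suc (card N)"
      unfolding N_def using card.remove[OF finM uv] .
    ultimately show False
      using max[of "insert {b, v} (insert {a, u} N)"] by simp
  qed
  ultimately have "k_stable I k M"
    using k_stable_if_no_short_augmenting_path[OF I assms(2) M _ _ assms(3)] by blast
  then show ?thesis ..
qed

section \<open>A while language compiled to random access machines\<close>

datatype var = Cnt | Arc | Vu | Vv | Va | Vb | Vw | Ptr | Tmp | Dif | Zer | One

datatype array = Src | Dst | Nxt | Head | Mate | Done

datatype com =
    Skip
  | Assign var nat
  | Plus var var var
  | Minus var var var
  | Get var array var
  | Put array var var
  | Input var
  | Output var
  | Seq com com (infixr ";;" 60)
  | Cond var com com
  | While var com

record state =
  var :: "var \<Rightarrow> nat"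
  arr :: "array \<Rightarrow> nat \<Rightarrow> nat"
  unread :: "nat list"
  printed :: "nat list"
  clock :: nat

abbreviation set_var :: "var \<Rightarrow> nat \<Rightarrow> state \<Rightarrow> state" where
  "set_var x c s \<equiv> s\<lparr>var := (var s)(x := c), clock := Suc (clock s)\<rparr>"

abbreviation set_arr :: "array \<Rightarrow> nat \<Rightarrow> nat \<Rightarrow> state \<Rightarrow> state" where
  "set_arr a j c s \<equiv> s\<lparr>arr := (arr s)(a := (arr s a)(j := c)), clock := Suc (clock s)\<rparr>"

abbreviation tick :: "state \<Rightarrow> state" where
  "tick s \<equiv> s\<lparr>clock := Suc (clock s)\<rparr>"

text \<open>
  In a derivation, \<open>B\<close> bounds the values of all variables and array entries, hence also all indices.
  A loop terminates because every iteration advances the clock, which its invariant \<open>J\<close> keeps below \<open>T\<close>.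
\<close>

fun wp :: "nat \<Rightarrow> nat \<Rightarrow> com \<Rightarrow> (state \<Rightarrow> bool) \<Rightarrow> state \<Rightarrow> bool" where
  "wp T B Skip Q s = Q s"
| "wp T B (Assign x c) Q s = (c \<le> B \<and> Q (set_var x c s))"
| "wp T B (Plus x y z) Q s = (var s y + var s z \<le> B \<and> Q (set_var x (var s y + var s z) s))"
| "wp T B (Minus x y z) Q s = Q (set_var x (var s y - var s z) s)"
| "wp T B (Get x a y) Q s = Q (set_var x (arr s a (var s y)) s)"
| "wp T B (Put a y x) Q s = Q (set_arr a (var s y) (var s x) s)"
| "wp T B (Input x) Q s =
     (let c = (case unread s of [] \<Rightarrow> 0 | c # _ \<Rightarrow> c)
      in c \<le> B \<and> Q ((set_var x c s)\<lparr>unread := tl (unread s)\<rparr>))"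
| "wp T B (Output x) Q s = Q ((tick s)\<lparr>printed := printed s @ [var s x]\<rparr>)"
| "wp T B (c ;; d) Q s = wp T B c (wp T B d Q) s"
| "wp T B (Cond x c d) Q s = (if var s x > 0 then wp T B c Q (tick s) else wp T B d Q (tick s))"
| "wp T B (While x c) Q s =
     (\<exists>J. J s \<and> (\<forall>s. J s \<longrightarrow> clock s \<le> T \<and>
        (if var s x > 0 then wp T B c J (tick s) else Q (tick s))))"

text \<open>
  Registers 0 and 1 are scratch space and the variables live below 16. The arrays are unbounded and
  therefore interleaved with stride 8, which can be computed by doubling.
\<close>

fun var_loc :: "var \<Rightarrow> nat" where
  "var_loc Cnt = 2"
| "var_loc Arc = 3"
| "var_loc Vu = 4"
| "var_loc Vv = 5"
| "var_loc Va = 6"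
| "var_loc Vb = 7"
| "var_loc Vw = 8"
| "var_loc Ptr = 9"
| "var_loc Tmp = 10"
| "var_loc Dif = 11"
| "var_loc Zer = 12"
| "var_loc One = 13"

fun array_base :: "array \<Rightarrow> nat" where
  "array_base Src = 16"
| "array_base Dst = 17"
| "array_base Nxt = 18"
| "array_base Head = 19"
| "array_base Mate = 20"
| "array_base Done = 21"

definition arr_loc :: "array \<Rightarrow> nat \<Rightarrow> nat" where
  "arr_loc a j = 8 * j + array_base a"

lemma var_loc_bounds: "2 \<le> var_loc x" "var_loc x < 16"
  by (cases x; simp)+

lemma var_loc_inj [simp]: "var_loc x = var_loc y \<longleftrightarrow> x = y"
  by (cases x; cases y; simp)

lemma array_base_bounds: "16 \<le> array_base a" "array_base a < 24"
  by (cases a; simp)+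

lemma array_base_inj: "array_base a = array_base b \<longleftrightarrow> a = b"
  by (cases a; cases b; simp)

lemma arr_loc_inj [simp]: "arr_loc a i = arr_loc b j \<longleftrightarrow> a = b \<and> i = j"
proof
  assume *: "arr_loc a i = arr_loc b j"
  have "i = j"
    using * array_base_bounds[of a] array_base_bounds[of b] unfolding arr_loc_def by linarith
  with * show "a = b \<and> i = j"
    by (simp add: arr_loc_def array_base_inj)
qed simp

lemma loc_neq [simp]:
  "var_loc x \<noteq> 0" "var_loc x \<noteq> Suc 0" "arr_loc a j \<noteq> 0" "arr_loc a j \<noteq> Suc 0"
  "arr_loc a j \<noteq> var_loc x" "var_loc x \<noteq> arr_loc a j"
  using var_loc_bounds[of x] array_base_bounds[of a] unfolding arr_loc_def by linarith+

definition address_code :: "array \<Rightarrow> var \<Rightarrow> instr list" where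
  "address_code a y =
     [Add 0 (var_loc y) (var_loc y), Add 0 0 0, Add 0 0 0, Const 1 (array_base a), Add 0 0 1]"

lemma length_address_code: "length (address_code a y) = 5"
  by (simp add: address_code_def)

text \<open>Jump targets are absolute, hence the start address \<open>p\<close>. The machine jumps
  only on positive values: the else branch comes first, and unconditional jumps test register 0
  after setting it to 1. A loop has its test behind the body, so that a repetition costs one
  jump.\<close>

fun compile :: "nat \<Rightarrow> com \<Rightarrow> instr list" where
  "compile p Skip = []"
| "compile p (Assign x c) = [Const (var_loc x) c]"
| "compile p (Plus x y z) = [Add (var_loc x) (var_loc y) (var_loc z)]"
| "compile p (Minus x y z) = [Sub (var_loc x) (var_loc y) (var_loc z)]"
| "compile p (Get x a y) = address_code a y @ [Load (var_loc x) 0]"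
| "compile p (Put a y x) = address_code a y @ [Store 0 (var_loc x)]"
| "compile p (Input x) = [Read (var_loc x)]"
| "compile p (Output x) = [Print (var_loc x)]"
| "compile p (c ;; d) = (let cs = compile p c in cs @ compile (p + length cs) d)"
| "compile p (Cond x c d) =
     (let ds = compile (p + 1) d; q = p + 3 + length ds; cs = compile q c
      in Jump_Pos (var_loc x) q # ds @ [Const 0 1, Jump_Pos 0 (q + length cs)] @ cs)"
| "compile p (While x c) =
     (let cs = compile (p + 2) c
      in [Const 0 1, Jump_Pos 0 (p + 2 + length cs)] @ cs @ [Jump_Pos (var_loc x) (p + 2)])"

section \<open>Bounded machine runs and the simulation by compiled code\<close>

definition code_at :: "instr list \<Rightarrow> nat \<Rightarrow> instr list \<Rightarrow> bool" where
  "code_at P p cs \<longleftrightarrow> (\<exists>xs ys. P = xs @ cs @ ys \<and> length xs = p)"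

lemma code_at_append:
  "code_at P p (cs @ ds) \<Longrightarrow> code_at P p cs \<and> code_at P (p + length cs) ds"
  unfolding code_at_def by (fastforce intro: exI[of _ "_ @ cs"])

lemma code_at_Cons:
  "code_at P p (i # cs) \<Longrightarrow> p < length P \<and> P ! p = i \<and> code_at P (Suc p) cs"
proof -
  assume "code_at P p (i # cs)"
  then obtain xs ys where P: "P = xs @ (i # cs) @ ys" "length xs = p"
    unfolding code_at_def by blast
  then have "code_at P (Suc p) cs"
    unfolding code_at_def by (intro exI[of _ "xs @ [i]"] exI[of _ ys]) simp
  with P show ?thesis
    by (simp add: nth_append)
qed

text \<open>In contrast to a mere iterate of \<open>step\<close>, a run also records that all
  registers stay below \<open>W\<close> in every configuration passed, including the last one. This
  is what the word size condition requires.\<close>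

inductive runs :: "instr list \<Rightarrow> nat \<Rightarrow> config \<Rightarrow> nat \<Rightarrow> config \<Rightarrow> bool" for P W where
  runs_refl: "(\<And>r. reg c r \<le> W) \<Longrightarrow> runs P W c 0 c"
| runs_step: "(\<And>r. reg c r \<le> W) \<Longrightarrow> pc c < length P \<Longrightarrow> runs P W (exec (P ! pc c) c) k c' \<Longrightarrow>
    runs P W c (Suc k) c'"

lemma runs_trans:
  assumes "runs P W a j b" and "runs P W b k c"
  shows "runs P W a (j + k) c"
  using assms by (induction rule: runs.induct) (auto intro: runs_step)

lemma funpow_step:
  "pc c < length P \<Longrightarrow> (step P ^^ Suc k) c = (step P ^^ k) (exec (P ! pc c) c)"
  unfolding funpow_Suc_right by (simp add: step_def halted_def)

lemma runs_funpow: "runs P W a k b \<Longrightarrow> (step P ^^ k) a = b"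
  by (induction rule: runs.induct) (simp_all add: funpow_step del: funpow.simps(2))

lemma runs_bounded: "runs P W a k b \<Longrightarrow> j \<le> k \<Longrightarrow> reg ((step P ^^ j) a) r \<le> W"
proof (induction arbitrary: j rule: runs.induct)
  case (runs_step c k c')
  then show ?case
    by (cases j) (simp_all add: funpow_step del: funpow.simps(2))
qed simp

text \<open>There are two bounds: \<open>B\<close> for the values visible to the while program and
  \<open>8 * B + 24\<close> for all registers, because scratch register 0 holds addresses
  \<open>8 * j + array_base a\<close> with \<open>j \<le> B\<close> and
  \<open>array_base a < 24\<close>.\<close>

definition represents :: "nat \<Rightarrow> state \<Rightarrow> config \<Rightarrow> bool" where
  "represents B s c \<longleftrightarrow>
     (\<forall>x. reg c (var_loc x) = var s x \<and> var s x \<le> B) \<and>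
     (\<forall>a j. reg c (arr_loc a j) = arr s a j \<and> arr s a j \<le> B) \<and>
     (\<forall>r. reg c r \<le> 8 * B + 24) \<and> inp c = unread s \<and> outp c = printed s"

fun straight_line :: "nat \<Rightarrow> instr list \<Rightarrow> config \<Rightarrow> bool" where
  "straight_line W [] c = (\<forall>r. reg c r \<le> W)"
| "straight_line W (i # cs) c =
     ((\<forall>r. reg c r \<le> W) \<and> pc (exec i c) = Suc (pc c) \<and> straight_line W cs (exec i c))"

lemma runs_straight_line:
  "code_at P (pc c) cs \<Longrightarrow> straight_line W cs c \<Longrightarrow> runs P W c (length cs) (fold exec cs c)"
proof (induction cs arbitrary: c)
  case (Cons i cs)
  then show ?case
    using runs_step[of c W P "length cs"] code_at_Cons[of P "pc c" i cs] by auto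
qed (auto intro: runs_refl)

lemma runs_exec:
  assumes "represents B s c" and "represents B s' (exec i c)"
    and "code_at P (pc c) [i]" and "pc (exec i c) = Suc (pc c)"
  shows "runs P (8 * B + 24) c 1 (exec i c)"
  using runs_straight_line[of P c "[i]" "8 * B + 24"] assms by (simp add: represents_def)

lemma runs_goto:
  assumes "\<And>r. reg c r \<le> W" and "W > 0" and code: "code_at P (pc c) [Const 0 1, Jump_Pos 0 q]"
  shows "runs P W c 2 (c\<lparr>pc := q, reg := (reg c)(0 := 1)\<rparr>)"
proof -
  let ?c1 = "exec (Const 0 1) c" and ?c2 = "c\<lparr>pc := q, reg := (reg c)(0 := 1)\<rparr>"
  note 1 = code_at_Cons[OF code]
  note 2 = code_at_Cons[OF conjunct2[OF conjunct2[OF 1]]]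
  have "runs P W ?c2 0 ?c2"
    using assms by (intro runs_refl) simp
  moreover have eq: "exec (P ! pc ?c1) ?c1 = ?c2"
    using 2 by simp
  ultimately have "runs P W (exec (P ! pc ?c1) ?c1) 0 ?c2"
    by (simp only:)
  then have "runs P W ?c1 (Suc 0) ?c2"
    using assms(1,2) 2 by (intro runs_step) simp_all
  then show ?thesis
    using runs_step[of c W P 1 ?c2] assms(1) 1 by (simp add: numeral_2_eq_2)
qed

lemma straight_line_address_code:
  assumes "represents B s c"
  shows "straight_line (8 * B + 24) (address_code a y) c"
    and "represents B s (fold exec (address_code a y) c)"
    and "reg (fold exec (address_code a y) c) 0 = arr_loc a (var s y)"
proof -
  have B: "var s y \<le> B" "reg c (var_loc y) = var s y" "\<And>r. reg c r \<le> 8 * B + 24"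
    using assms(1) by (auto simp: represents_def)
  have b: "array_base a < 24" using array_base_bounds by blast
  have loc: "arr_loc a (var s y) \<le> 8 * B + 24"
    using B(1) b by (simp add: arr_loc_def)
  \<comment> \<open>The left-hand side is the address in the form that three unfolded doublings
    leave behind.\<close>
  then have sum: "var s y + var s y + (var s y + var s y) +
      (var s y + var s y + (var s y + var s y)) + array_base a \<le> 8 * B + 24"
    by (simp add: arr_loc_def)
  show "straight_line (8 * B + 24) (address_code a y) c"
    using B b by (auto simp: address_code_def)
  show "represents B s (fold exec (address_code a y) c)"
    using assms b B(2) sum by (auto simp: represents_def address_code_def)
  show "reg (fold exec (address_code a y) c) 0 = arr_loc a (var s y)"
    using B by (auto simp: arr_loc_def address_code_def)
qed

text \<open>Six machine steps per clock tick are the price of an array access: five instructions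
  compute the address, one performs the access. All other constructs spend at most three
  instructions of their own per tick.\<close>

lemma wp_sound:
  assumes "wp T B c Q s" and "represents B s conf" and "code_at P (pc conf) (compile (pc conf) c)"
  shows "\<exists>conf' s' k. runs P (8 * B + 24) conf k conf' \<and>
    pc conf' = pc conf + length (compile (pc conf) c) \<and> represents B s' conf' \<and> Q s' \<and>
    clock s \<le> clock s' \<and> k + 6 * clock s \<le> 6 * clock s'"
    (is "\<exists>conf' s' k. ?R conf s c Q conf' s' k")
  using assms
proof (induction c arbitrary: Q s conf)
  case Skip
  then have "runs P (8 * B + 24) conf 0 conf"
    by (intro runs_refl) (simp add: represents_def)
  with Skip show ?case by fastforce
next
  case (Assign x v)
  let ?i = "Const (var_loc x) v" and ?s = "set_var x v s"
  have rep: "represents B ?s (exec ?i conf)"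
    using Assign by (auto simp: represents_def)
  moreover have "runs P (8 * B + 24) conf 1 (exec ?i conf)"
    using runs_exec[OF Assign.prems(2) rep] Assign.prems(3) by simp
  ultimately show ?case
    using Assign.prems(1)
    by (intro exI[of _ "exec ?i conf"] exI[of _ ?s] exI[of _ 1]) auto
next
  case (Plus x y z)
  let ?i = "Add (var_loc x) (var_loc y) (var_loc z)" and ?s = "set_var x (var s y + var s z) s"
  have rep: "represents B ?s (exec ?i conf)"
    using Plus by (auto simp: represents_def)
  moreover have "runs P (8 * B + 24) conf 1 (exec ?i conf)"
    using runs_exec[OF Plus.prems(2) rep] Plus.prems(3) by simp
  ultimately show ?case
    using Plus.prems(1)
    by (intro exI[of _ "exec ?i conf"] exI[of _ ?s] exI[of _ 1]) auto
next
  case (Minus x y z)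
  let ?i = "Sub (var_loc x) (var_loc y) (var_loc z)" and ?s = "set_var x (var s y - var s z) s"
  have "var s y \<le> B"
    using Minus.prems(2) by (simp add: represents_def)
  then have "var s y - var s z \<le> B" "var s y - var s z \<le> 8 * B + 24"
    by simp_all
  then have rep: "represents B ?s (exec ?i conf)"
    using Minus by (auto simp: represents_def)
  moreover have "runs P (8 * B + 24) conf 1 (exec ?i conf)"
    using runs_exec[OF Minus.prems(2) rep] Minus.prems(3) by simp
  ultimately show ?case
    using Minus.prems(1)
    by (intro exI[of _ "exec ?i conf"] exI[of _ ?s] exI[of _ 1]) auto
next
  case (Input x)
  let ?v = "case unread s of [] \<Rightarrow> 0 | c # _ \<Rightarrow> c"
  let ?i = "Read (var_loc x)" and ?s = "(set_var x ?v s)\<lparr>unread := tl (unread s)\<rparr>"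
  have rep: "represents B ?s (exec ?i conf)"
    using Input by (auto simp: represents_def Let_def)
  moreover have "runs P (8 * B + 24) conf 1 (exec ?i conf)"
    using runs_exec[OF Input.prems(2) rep] Input.prems(3) by simp
  ultimately show ?case
    using Input.prems(1)
    by (intro exI[of _ "exec ?i conf"] exI[of _ ?s] exI[of _ 1]) (auto simp: Let_def)
next
  case (Output x)
  let ?i = "Print (var_loc x)" and ?s = "(tick s)\<lparr>printed := printed s @ [var s x]\<rparr>"
  have rep: "represents B ?s (exec ?i conf)"
    using Output by (auto simp: represents_def)
  moreover have "runs P (8 * B + 24) conf 1 (exec ?i conf)"
    using runs_exec[OF Output.prems(2) rep] Output.prems(3) by simp
  ultimately show ?case
    using Output.prems(1)
    by (intro exI[of _ "exec ?i conf"] exI[of _ ?s] exI[of _ 1]) auto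
next
  case (Get x a y)
  let ?conf = "fold exec (address_code a y) conf"
  let ?i = "Load (var_loc x) 0" and ?s = "set_var x (arr s a (var s y)) s"
  have c: "code_at P (pc conf) (address_code a y)" "code_at P (pc conf + 5) [?i]"
    using Get.prems(3) code_at_append[of P "pc conf" "address_code a y" "[?i]"]
    by (auto simp: length_address_code)
  have p: "pc ?conf = pc conf + 5"
    by (simp add: address_code_def)
  note line = straight_line_address_code[OF Get.prems(2), of a y]
  have "arr s a (var s y) \<le> B"
    using Get.prems(2) by (simp add: represents_def)
  then have "arr s a (var s y) \<le> 8 * B + 24"
    by simp
  with line have rep: "represents B ?s (exec ?i ?conf)"
    by (auto simp: represents_def)
  moreover have "runs P (8 * B + 24) ?conf 1 (exec ?i ?conf)"
    using runs_exec[OF line(2) rep] c(2) p by simp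
  then have "runs P (8 * B + 24) conf 6 (exec ?i ?conf)"
    using runs_trans[OF runs_straight_line[OF c(1) line(1)]] by (fastforce simp: length_address_code)
  ultimately show ?case
    using Get.prems(1) p
    by (intro exI[of _ "exec ?i ?conf"] exI[of _ ?s] exI[of _ 6]) (auto simp: length_address_code)
next
  case (Put a y x)
  let ?conf = "fold exec (address_code a y) conf"
  let ?i = "Store 0 (var_loc x)" and ?s = "set_arr a (var s y) (var s x) s"
  have c: "code_at P (pc conf) (address_code a y)" "code_at P (pc conf + 5) [?i]"
    using Put.prems(3) code_at_append[of P "pc conf" "address_code a y" "[?i]"]
    by (auto simp: length_address_code)
  have p: "pc ?conf = pc conf + 5"
    by (simp add: address_code_def)
  note line = straight_line_address_code[OF Put.prems(2), of a y]
  have "var s x \<le> B"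
    using Put.prems(2) by (simp add: represents_def)
  then have "var s x \<le> 8 * B + 24"
    by simp
  with line have rep: "represents B ?s (exec ?i ?conf)"
    by (auto simp: represents_def)
  moreover have "runs P (8 * B + 24) ?conf 1 (exec ?i ?conf)"
    using runs_exec[OF line(2) rep] c(2) p by simp
  then have "runs P (8 * B + 24) conf 6 (exec ?i ?conf)"
    using runs_trans[OF runs_straight_line[OF c(1) line(1)]] by (fastforce simp: length_address_code)
  ultimately show ?case
    using Put.prems(1) p
    by (intro exI[of _ "exec ?i ?conf"] exI[of _ ?s] exI[of _ 6]) (auto simp: length_address_code)
next
  case (Seq c d)
  let ?cs = "compile (pc conf) c"
  have code: "code_at P (pc conf) ?cs"
    "code_at P (pc conf + length ?cs) (compile (pc conf + length ?cs) d)"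
    using Seq.prems(3) code_at_append by (auto simp: Let_def)
  obtain conf1 s1 k1 where 1: "?R conf s c (wp T B d Q) conf1 s1 k1"
    using Seq.IH(1)[OF _ Seq.prems(2) code(1), of "wp T B d Q"] Seq.prems(1) by auto
  obtain conf2 s2 k2 where 2: "?R conf1 s1 d Q conf2 s2 k2"
    using Seq.IH(2)[of Q s1 conf1] 1 code(2) by auto
  have "runs P (8 * B + 24) conf (k1 + k2) conf2"
    using runs_trans 1 2 by blast
  then show ?case
    using 1 2 by (intro exI[of _ conf2] exI[of _ s2] exI[of _ "k1 + k2"]) (auto simp: Let_def)
next
  case (Cond x c d)
  define ds where "ds = compile (pc conf + 1) d"
  define q where "q = pc conf + 3 + length ds"
  define cs where "cs = compile q c"
  have comp: "compile (pc conf) (Cond x c d) =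
      Jump_Pos (var_loc x) q # ds @ [Const 0 1, Jump_Pos 0 (q + length cs)] @ cs"
    by (simp add: Let_def cs_def ds_def q_def)
  have at: "code_at P (pc conf) (Jump_Pos (var_loc x) q # ds @ [Const 0 1, Jump_Pos 0 (q + length cs)] @ cs)"
    using Cond.prems(3) unfolding comp .
  have jump: "pc conf < length P" "P ! pc conf = Jump_Pos (var_loc x) q"
    using code_at_Cons[OF at] by auto
  have code: "code_at P (Suc (pc conf)) ds" "code_at P q cs"
    "code_at P (pc conf + 1 + length ds) [Const 0 1, Jump_Pos 0 (q + length cs)]"
    using code_at_append[OF conjunct2[OF conjunct2[OF code_at_Cons[OF at]]]]
      code_at_append[of P "pc conf + 1 + length ds" "[Const 0 1, Jump_Pos 0 (q + length cs)]" cs]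
    by (auto simp: q_def numeral_3_eq_3)
  have val: "reg conf (var_loc x) = var s x" and bnd: "\<And>r. reg conf r \<le> 8 * B + 24"
    using Cond.prems(2) by (auto simp: represents_def)
  show ?case
  proof (cases "var s x > 0")
    case True
    define conf1 where "conf1 = conf\<lparr>pc := q\<rparr>"
    have conf1: "exec (P ! pc conf) conf = conf1"
      using jump val True by (simp add: conf1_def)
    obtain conf2 s2 k2 where 2: "?R conf1 (tick s) c Q conf2 s2 k2"
      using Cond.IH(1)[of Q "tick s" conf1] True Cond.prems(1,2) code(2)
      by (auto simp: conf1_def represents_def cs_def)
    have "runs P (8 * B + 24) conf (Suc k2) conf2"
      using runs_step[of conf _ P] bnd jump(1) conf1 2 by auto
    moreover have "pc conf2 = pc conf + length (compile (pc conf) (Cond x c d))"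
      using 2 unfolding comp by (simp add: conf1_def cs_def q_def)
    ultimately show ?thesis
      using 2 by (intro exI[of _ conf2] exI[of _ s2] exI[of _ "Suc k2"]) auto
  next
    case False
    define conf1 where "conf1 = conf\<lparr>pc := Suc (pc conf)\<rparr>"
    have conf1: "exec (P ! pc conf) conf = conf1"
      using jump val False by (simp add: conf1_def)
    obtain conf2 s2 k2 where 2: "?R conf1 (tick s) d Q conf2 s2 k2"
      using Cond.IH(2)[of Q "tick s" conf1] False Cond.prems(1,2) code(1)
      by (auto simp: conf1_def represents_def ds_def)
    then have bnd2: "\<And>r. reg conf2 r \<le> 8 * B + 24"
      by (auto simp: represents_def)
    have pc2: "pc conf2 = pc conf + 1 + length ds"
      using 2 by (simp add: conf1_def ds_def)
    define conf3 where "conf3 = conf2\<lparr>pc := q + length cs, reg := (reg conf2)(0 := 1)\<rparr>"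
    have "runs P (8 * B + 24) conf2 2 conf3"
      using runs_goto[of conf2 "8 * B + 24" P "q + length cs"] bnd2 pc2 code(3) by (simp add: conf3_def)
    then have "runs P (8 * B + 24) conf1 (k2 + 2) conf3"
      using runs_trans 2 by blast
    then have "runs P (8 * B + 24) conf (Suc (k2 + 2)) conf3"
      using runs_step[of conf _ P] bnd jump(1) conf1 by auto
    moreover have "represents B s2 conf3"
      using 2 by (auto simp: represents_def conf3_def)
    moreover have "pc conf3 = pc conf + length (compile (pc conf) (Cond x c d))"
      unfolding comp by (simp add: conf3_def q_def)
    ultimately show ?thesis
      using 2 by (intro exI[of _ conf3] exI[of _ s2] exI[of _ "Suc (k2 + 2)"]) auto
  qed
next
  case (While x c)
  define p where "p = pc conf + 2"
  define cs where "cs = compile p c"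
  have comp: "compile (pc conf) (While x c) =
      [Const 0 1, Jump_Pos 0 (p + length cs)] @ cs @ [Jump_Pos (var_loc x) p]"
    by (simp add: Let_def cs_def p_def)
  have code: "code_at P p cs" "code_at P (pc conf) [Const 0 1, Jump_Pos 0 (p + length cs)]"
    and jump: "p + length cs < length P" "P ! (p + length cs) = Jump_Pos (var_loc x) p"
    using While.prems(3) code_at_append[of P "pc conf" "[Const 0 1, Jump_Pos 0 (p + length cs)]"]
      code_at_append[of P p cs] unfolding comp
    by (auto dest!: code_at_Cons simp: p_def)
  obtain J where "J s" and J: "\<And>s. J s \<Longrightarrow> clock s \<le> T \<and>
      (if var s x > 0 then wp T B c J (tick s) else Q (tick s))"
    using While.prems(1) by auto
  \<comment> \<open>The summand 2 reserves the two instructions that enter the loop; the tick of the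
    final test, which takes one step, has room for them.\<close>
  have loop: "\<exists>conf' s' k. runs P (8 * B + 24) conf1 k conf' \<and>
      pc conf' = Suc (p + length cs) \<and> represents B s' conf' \<and> Q s' \<and>
      clock s \<le> clock s' \<and> k + 2 + 6 * clock s \<le> 6 * clock s'"
    if "J s" "represents B s conf1" "pc conf1 = p + length cs" for s conf1
    using that
  proof (induction "T - clock s" arbitrary: s conf1 rule: less_induct)
    case less
    have val: "reg conf1 (var_loc x) = var s x" and bnd: "\<And>r. reg conf1 r \<le> 8 * B + 24"
      using less.prems(2) by (auto simp: represents_def)
    show ?case
    proof (cases "var s x > 0")
      case True
      define conf2 where "conf2 = conf1\<lparr>pc := p\<rparr>"
      have conf2: "exec (P ! pc conf1) conf1 = conf2"
        using jump val True less.prems(3) by (simp add: conf2_def)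
      obtain conf3 s3 k3 where 3: "?R conf2 (tick s) c J conf3 s3 k3"
        using While.IH[of J "tick s" conf2] J[OF less.prems(1)] True less.prems(2) code(1)
        by (auto simp: conf2_def represents_def cs_def)
      have "T - clock s3 < T - clock s"
        using J[of s3] 3 by auto
      then obtain conf4 s4 k4 where 4: "runs P (8 * B + 24) conf3 k4 conf4"
        "pc conf4 = Suc (p + length cs)" "represents B s4 conf4" "Q s4"
        "clock s3 \<le> clock s4" "k4 + 2 + 6 * clock s3 \<le> 6 * clock s4"
        using less.hyps[of s3 conf3] 3 by (auto simp: conf2_def cs_def)
      have "runs P (8 * B + 24) conf2 (k3 + k4) conf4"
        using runs_trans 3 4(1) by blast
      then have "runs P (8 * B + 24) conf1 (Suc (k3 + k4)) conf4"
        using runs_step[of conf1 _ P] bnd jump(1) conf2 less.prems(3) by auto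
      then show ?thesis
        using 3 4 by (intro exI[of _ conf4] exI[of _ s4] exI[of _ "Suc (k3 + k4)"]) auto
    next
      case False
      define conf2 where "conf2 = conf1\<lparr>pc := Suc (p + length cs)\<rparr>"
      have conf2: "exec (P ! pc conf1) conf1 = conf2"
        using jump val False less.prems(3) by (simp add: conf2_def)
      have "runs P (8 * B + 24) conf1 1 conf2"
        using runs_step[of conf1 "8 * B + 24" P 0 conf2] bnd jump(1) conf2 less.prems(3)
          runs_refl[of conf2 "8 * B + 24" P] by (auto simp: conf2_def)
      then show ?thesis
        using J[OF less.prems(1)] False less.prems(2)
        by (intro exI[of _ conf2] exI[of _ "tick s"] exI[of _ 1])
          (auto simp: conf2_def represents_def)
    qed
  qed
  have bnd: "\<And>r. reg conf r \<le> 8 * B + 24"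
    using While.prems(2) by (auto simp: represents_def)
  define conf1 where "conf1 = conf\<lparr>pc := p + length cs, reg := (reg conf)(0 := 1)\<rparr>"
  have 1: "runs P (8 * B + 24) conf 2 conf1"
    using runs_goto[of conf "8 * B + 24" P "p + length cs"] bnd code(2) by (simp add: conf1_def)
  have "represents B s conf1" "pc conf1 = p + length cs"
    using While.prems(2) by (auto simp: represents_def conf1_def)
  then obtain conf2 s2 k2 where 2: "runs P (8 * B + 24) conf1 k2 conf2"
    "pc conf2 = Suc (p + length cs)" "represents B s2 conf2" "Q s2"
    "clock s \<le> clock s2" "k2 + 2 + 6 * clock s \<le> 6 * clock s2"
    using loop[OF \<open>J s\<close>] by blast
  have "pc conf2 = pc conf + length (compile (pc conf) (While x c))"
    using 2(2) unfolding comp by (simp add: p_def)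
  then show ?case
    using 2 runs_trans[OF 1 2(1)]
    by (intro exI[of _ conf2] exI[of _ s2] exI[of _ "2 + k2"]) auto
qed

declare wp.simps(11) [simp del]

text \<open>Loops are handled only through this rule. Their defining equation, which would leave an
  existentially quantified invariant, is withdrawn from the simplifier.\<close>

lemma wp_While:
  assumes "J s" and "\<And>s. J s \<Longrightarrow> clock s \<le> T"
    and "\<And>s. J s \<Longrightarrow> var s x > 0 \<Longrightarrow> wp T B c J (tick s)"
    and "\<And>s. J s \<Longrightarrow> var s x = 0 \<Longrightarrow> Q (tick s)"
  shows "wp T B (While x c) Q s"
  unfolding wp.simps using assms by (intro exI[of _ J]) simp

definition initial_state :: "nat list \<Rightarrow> state" where
  "initial_state xs = \<lparr>var = \<lambda>_. 0, arr = \<lambda>_ _. 0, unread = xs, printed = [], clock = 0\<rparr>"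

lemma wp_computes_within:
  assumes "wp T B c Q (initial_state xs)"
  shows "\<exists>s. Q s \<and> computes_within (compile 0 c) xs (6 * real (clock s)) (8 * B + 24) (printed s)"
proof -
  let ?P = "compile 0 c"
  define conf where "conf = \<lparr>pc = 0, reg = (\<lambda>_. 0 :: nat), inp = xs, outp = []\<rparr>"
  have "represents B (initial_state xs) conf" "code_at ?P (pc conf) (compile (pc conf) c)"
    by (auto simp: represents_def initial_state_def conf_def code_at_def)
  then obtain conf' s k where r: "runs ?P (8 * B + 24) conf k conf'" and pc: "pc conf' = length ?P"
    and rep: "represents B s conf'" and Q: "Q s" and k: "k \<le> 6 * clock s"
    using wp_sound[OF assms, of conf ?P] by (auto simp: conf_def initial_state_def)
  have at: "config_after ?P xs t = (step ?P ^^ t) conf" for t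
    by (simp add: config_after_def conf_def)
  have k_conf: "(step ?P ^^ k) conf = conf'"
    using runs_funpow[OF r] .
  \<comment> \<open>The register bound of \<open>computes_within\<close> ranges over all times,
    hence also over those after halting.\<close>
  have idle: "(step ?P ^^ t) conf' = conf'" for t
    by (induction t) (simp_all add: step_def halted_def pc)
  have "reg ((step ?P ^^ t) conf) i \<le> 8 * B + 24" for t i
  proof (cases "t \<le> k")
    case True
    then show ?thesis
      using runs_bounded[OF r] by blast
  next
    case False
    then have "(step ?P ^^ t) conf = (step ?P ^^ (t - k)) ((step ?P ^^ k) conf)"
      by (simp add: funpow_add[symmetric, THEN fun_cong, unfolded comp_def])
    then have "(step ?P ^^ t) conf = conf'"
      by (simp only: k_conf idle)
    then show ?thesis
      using rep by (simp add: represents_def)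
  qed
  moreover have "real k \<le> 6 * real (clock s)"
    using k by linarith
  moreover have "halted ?P conf'" "outp conf' = printed s"
    using pc rep by (auto simp: halted_def represents_def)
  ultimately have "computes_within ?P xs (6 * real (clock s)) (8 * B + 24) (printed s)"
    unfolding computes_within_def at using k_conf by auto
  with Q show ?thesis by blast
qed

section \<open>Augmenting paths of length 3\<close>

text \<open>
  From here on agent \<open>i\<close> is the vertex \<open>i + 1\<close>, so that 0 stands for an unmatched vertex in \<open>Mate\<close> and
  for the end of an adjacency list in \<open>Head\<close> and \<open>Nxt\<close>. Arcs are numbered from 1 and each edge
  contributes both of its orientations.
\<close>

definition arcs :: "(nat \<Rightarrow> nat) \<Rightarrow> (nat \<Rightarrow> nat) \<Rightarrow> nat \<Rightarrow> (nat \<times> nat) set" where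
  "arcs src dst K = (\<lambda>k. (src k, dst k)) ` {1..K}"

text \<open>Linked lists into which arcs are pushed at the front, so indices decrease along each
  list: \<open>head u\<close> is the largest arc with source \<open>u\<close>, and
  \<open>nxt k\<close> the next smaller one with the source of \<open>k\<close>. Consequently the
  arcs already visited are exactly those of the list above the current pointer.\<close>

definition adjacency :: "(nat \<Rightarrow> nat) \<Rightarrow> (nat \<Rightarrow> nat) \<Rightarrow> (nat \<Rightarrow> nat) \<Rightarrow> nat \<Rightarrow> bool" where
  "adjacency src nxt head K \<longleftrightarrow>
     (\<forall>u. head u \<le> K \<and> (head u \<noteq> 0 \<longrightarrow> src (head u) = u) \<and>
        (\<forall>k. head u < k \<and> k \<le> K \<longrightarrow> src k \<noteq> u)) \<and>
     (\<forall>k. 1 \<le> k \<and> k \<le> K \<longrightarrow> nxt k < k \<and> (nxt k \<noteq> 0 \<longrightarrow> src (nxt k) = src k) \<and>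
        (\<forall>j. nxt k < j \<and> j < k \<longrightarrow> src j \<noteq> src k))"

lemma arcs_Suc:
  "arcs (src(Suc K := u)) (dst(Suc K := v)) (Suc K) = insert (u, v) (arcs src dst K)"
proof -
  have "{1..Suc K} = insert (Suc K) {1..K}"
    by auto
  moreover have "(\<lambda>k. ((src(Suc K := u)) k, (dst(Suc K := v)) k)) ` {1..K} = (\<lambda>k. (src k, dst k)) ` {1..K}"
    by (intro image_cong) auto
  ultimately show ?thesis
    unfolding arcs_def by simp
qed

text \<open>The new index \<open>Suc K\<close> exceeds every stored one, so no old pointer refers to
  it and the lists stay decreasing.\<close>

lemma adjacency_Suc:
  assumes "adjacency src nxt head K"
  shows "adjacency (src(Suc K := u)) (nxt(Suc K := head u)) (head(u := Suc K)) (Suc K)"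
proof -
  have "head v < Suc K" for v
    using assms by (simp add: adjacency_def less_Suc_eq_le)
  moreover have "head v \<noteq> Suc K" for v
    using assms Suc_n_not_le_n[of K] unfolding adjacency_def by metis
  moreover have "nxt k \<noteq> Suc K" if "1 \<le> k" "k \<le> K" for k
    using assms that unfolding adjacency_def by fastforce
  moreover have "\<not> head (src j) < j" if "j \<le> K" for j
    using assms that unfolding adjacency_def by blast
  ultimately show ?thesis
    using assms unfolding adjacency_def by (auto simp: le_Suc_eq less_Suc_eq)
qed

section \<open>Building adjacency lists and searching them for unmatched neighbours\<close>

definition graph :: "nat \<Rightarrow> (nat \<times> nat) set \<Rightarrow> state \<Rightarrow> bool" where
  "graph K E s \<longleftrightarrow> adjacency (arr s Src) (arr s Nxt) (arr s Head) K \<and>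
     arcs (arr s Src) (arr s Dst) K = E \<and> var s One = 1 \<and> var s Zer = 0"

definition push :: "var \<Rightarrow> var \<Rightarrow> com" where
  "push x y =
     Plus Arc Arc One ;; Put Src Arc x ;; Put Dst Arc y ;;
     Get Tmp Head x ;; Put Nxt Arc Tmp ;; Put Head x Arc"

text \<open>Like the later command specifications, this is stated for an arbitrary postcondition
  \<open>Q\<close>, and the last premise lists all that \<open>Q\<close> may rely on. Specifications
  can thus be chained without a consequence rule for \<open>wp\<close>.\<close>

lemma wp_push:
  assumes "graph K E s" and "var s Arc = K" and "Suc K \<le> B"
    and "x \<notin> {Arc, Tmp}" and "y \<notin> {Arc, Tmp}"
    and "\<And>s'. graph (Suc K) (insert (var s x, var s y) E) s' \<Longrightarrow> var s' Arc = Suc K \<Longrightarrow>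
      (\<And>z. z \<notin> {Arc, Tmp} \<Longrightarrow> var s' z = var s z) \<Longrightarrow>
      arr s' Mate = arr s Mate \<Longrightarrow> arr s' Done = arr s Done \<Longrightarrow>
      unread s' = unread s \<Longrightarrow> printed s' = printed s \<Longrightarrow> clock s' = clock s + 6 \<Longrightarrow> Q s'"
  shows "wp T B (push x y) Q s"
proof -
  have "var s One = 1"
    using assms(1) by (simp add: graph_def)
  with assms(1-5) show ?thesis
    unfolding push_def
    by (auto intro!: assms(6) simp: graph_def adjacency_Suc arcs_Suc split: if_splits)
qed

text \<open>The sum of both truncated differences is the absolute difference. It is 0 iff the values
  agree, which makes it the equality test of the language.\<close>

definition dist :: "var \<Rightarrow> var \<Rightarrow> com" where
  "dist x y = Minus Dif x y ;; Minus Tmp y x ;; Plus Dif Dif Tmp"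

text \<open>The vertex in \<open>y\<close> is excluded from the search; passing \<open>Zer\<close>
  excludes nothing, since vertices are positive. There is no early exit: the whole list is scanned
  and the last hit is kept.\<close>

definition find_free :: "var \<Rightarrow> var \<Rightarrow> var \<Rightarrow> com" where
  "find_free r x y =
     Assign r 0 ;; Get Ptr Head x ;;
     While Ptr
       (Get Vw Dst Ptr ;; dist Vw y ;; Get Tmp Mate Vw ;;
        Cond Tmp Skip (Cond Dif (Plus r Vw Zer) Skip) ;;
        Get Ptr Nxt Ptr)"

definition free_neighbour :: "(nat \<times> nat) set \<Rightarrow> (nat \<Rightarrow> nat) \<Rightarrow> nat \<Rightarrow> nat \<Rightarrow> nat \<Rightarrow> bool" where
  "free_neighbour E mate u y w \<longleftrightarrow> (u, w) \<in> E \<and> mate w = 0 \<and> w \<noteq> y"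

definition simple_arcs :: "nat \<Rightarrow> (nat \<times> nat) set \<Rightarrow> bool" where
  "simple_arcs n E \<longleftrightarrow> sym E \<and> (\<forall>(u, v) \<in> E. u \<noteq> v \<and> 0 < u \<and> u \<le> n \<and> 0 < v \<and> v \<le> n)"

definition out_degree :: "(nat \<Rightarrow> nat) \<Rightarrow> nat \<Rightarrow> nat \<Rightarrow> nat" where
  "out_degree src K u = card {k \<in> {1..K}. src k = u}"

text \<open>The invariant says that all arcs of the list above \<open>Ptr\<close> have been
  examined. An iteration takes at most 12 ticks, and 10 covers the work outside the loop. The result
  0 unambiguously signals failure.\<close>

lemma wp_find_free:
  assumes graph: "graph K E s" and E: "simple_arcs n E" and B: "2 * n \<le> B" and y: "var s y \<le> n"
    and vars: "r \<in> {Va, Vb}" "x \<in> {Vu, Vv}" "y \<in> {Va, Vb, Zer}" "y \<noteq> r"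
    and T: "clock s + 12 * out_degree (arr s Src) K (var s x) + 10 \<le> T"
    and Q: "\<And>s'. (\<And>z. z \<notin> {r, Ptr, Vw, Tmp, Dif} \<Longrightarrow> var s' z = var s z) \<Longrightarrow>
      arr s' = arr s \<Longrightarrow> unread s' = unread s \<Longrightarrow> printed s' = printed s \<Longrightarrow>
      clock s' \<le> clock s + 12 * out_degree (arr s Src) K (var s x) + 10 \<Longrightarrow>
      (\<And>w. free_neighbour E (arr s Mate) (var s x) (var s y) w \<Longrightarrow> var s' r \<noteq> 0) \<Longrightarrow>
      (var s' r \<noteq> 0 \<Longrightarrow> free_neighbour E (arr s Mate) (var s x) (var s y) (var s' r)) \<Longrightarrow>
      Q s'"
  shows "wp T B (find_free r x y) Q s"
proof -
  let ?free = "free_neighbour E (arr s Mate) (var s x) (var s y)"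
  let ?src = "arr s Src" and ?dst = "arr s Dst" and ?nxt = "arr s Nxt" and ?head = "arr s Head"
  \<comment> \<open>The arcs up to \<open>p\<close> with the scanned source are the unvisited rest
    of the list. Their number drops with every move along \<open>nxt\<close> and pays for the
    iterations.\<close>
  define left where "left p = out_degree ?src p (var s x)" for p
  define J where "J s' \<longleftrightarrow>
      (\<forall>z. z \<notin> {r, Ptr, Vw, Tmp, Dif} \<longrightarrow> var s' z = var s z) \<and>
      arr s' = arr s \<and> unread s' = unread s \<and> printed s' = printed s \<and>
      var s' Ptr \<le> K \<and> (var s' Ptr \<noteq> 0 \<longrightarrow> ?src (var s' Ptr) = var s x) \<and>
      (\<forall>k. var s' Ptr < k \<and> k \<le> K \<and> ?src k = var s x \<and> ?free (?dst k) \<longrightarrow> var s' r \<noteq> 0) \<and>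
      (var s' r \<noteq> 0 \<longrightarrow> ?free (var s' r)) \<and>
      clock s' + 12 * left (var s' Ptr) \<le> clock s + 12 * left K + 2" for s' :: state
  have adj: "adjacency ?src ?nxt ?head K" and arcs: "arcs ?src ?dst K = E"
    and one: "var s One = 1" "var s Zer = 0"
    using graph by (auto simp: graph_def)
  have left_mono: "p \<le> q \<Longrightarrow> left p \<le> left q" for p q
    unfolding left_def out_degree_def by (intro card_mono) auto
  have left_step: "left (?nxt p) < left p" if "1 \<le> p" "p \<le> K" "?src p = var s x" for p
  proof -
    have "?nxt p < p"
      using adj that unfolding adjacency_def by blast
    moreover from this have "p \<in> {k \<in> {1..p}. ?src k = var s x}" "p \<notin> {k \<in> {1..?nxt p}. ?src k = var s x}"
      using that by auto
    moreover have "{k \<in> {1..?nxt p}. ?src k = var s x} \<subseteq> {k \<in> {1..p}. ?src k = var s x}"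
      using \<open>?nxt p < p\<close> by auto
    ultimately have "{k \<in> {1..?nxt p}. ?src k = var s x} \<subset> {k \<in> {1..p}. ?src k = var s x}"
      by blast
    then show ?thesis
      unfolding left_def out_degree_def by (intro psubset_card_mono) auto
  qed
  have inE: "k \<in> {1..K} \<Longrightarrow> (?src k, ?dst k) \<in> E" for k
    using arcs by (auto simp: arcs_def)
  have dst_le: "?dst k \<le> n" if "k \<in> {1..K}" for k
    using inE[OF that] E by (auto simp: simple_arcs_def)
  have fix_vars: "z \<notin> {r, Ptr, Vw, Tmp, Dif}" if "z \<in> {x, y, Zer, One}" for z
    using that vars by auto
  have ne: "r \<noteq> Ptr" "r \<noteq> Vw" "r \<noteq> Tmp" "r \<noteq> Dif" "r \<noteq> Zer" "y \<noteq> r"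
    "x \<noteq> r" "x \<noteq> Ptr" "x \<noteq> Vw" "x \<noteq> Tmp" "x \<noteq> Dif" "y \<noteq> Ptr" "y \<noteq> Vw" "y \<noteq> Tmp" "y \<noteq> Dif"
    using vars by auto
  note ne = ne ne[symmetric]
  show ?thesis
    unfolding find_free_def dist_def wp.simps(1-10)
  proof (intro conjI, simp, rule wp_While[where J = J])
    show "J (set_var Ptr (arr (set_var r 0 s) Head (var (set_var r 0 s) x)) (set_var r 0 s))"
      using adj vars left_mono[of "?head (var s x)" K] unfolding J_def adjacency_def by auto
  next
    fix s' assume "J s'"
    then show "clock s' \<le> T"
      using T by (simp add: J_def left_def)
  next
    fix s' assume J: "J s'" and "0 < var s' Ptr"
    define p where "p = var s' Ptr"
    have p: "1 \<le> p" "p \<le> K" "?src p = var s x"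
      using J \<open>0 < var s' Ptr\<close> by (auto simp: J_def p_def)
    have nxt: "?nxt p < p" "?nxt p \<noteq> 0 \<Longrightarrow> ?src (?nxt p) = var s x"
      "\<And>j. ?nxt p < j \<Longrightarrow> j < p \<Longrightarrow> ?src j \<noteq> var s x"
      using conjunct2[OF adj[unfolded adjacency_def], rule_format, OF conjI[OF p(1,2)]] p(3) by auto
    have w: "?dst p \<le> n" "(var s x, ?dst p) \<in> E" "?dst p \<noteq> 0"
      using dst_le[of p] inE[of p] p E by (auto simp: simple_arcs_def)
    have vx: "var s' x = var s x" "var s' y = var s y" "var s' Zer = 0" "arr s' = arr s"
      using J fix_vars one by (auto simp: J_def)
    have seen: "k = p \<or> p < k" if "?nxt p < k" "?src k = var s x" for k
      using nxt(3)[of k] that by linarith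
    have cl: "clock s' + 12 * left p \<le> clock s + 12 * left K + 2"
      using J by (simp add: J_def p_def)
    have J_next: "J s''"
      if "\<And>z. z \<notin> {r, Ptr, Vw, Tmp, Dif} \<Longrightarrow> var s'' z = var s' z"
        and s'': "arr s'' = arr s'" "unread s'' = unread s'" "printed s'' = printed s'"
          "var s'' Ptr = ?nxt p" "clock s'' \<le> clock s' + 12"
          "var s'' r = (if arr s Mate (?dst p) = 0 \<and> ?dst p \<noteq> var s y then ?dst p else var s' r)"
      for s'' :: state
    proof -
      have "var s'' r \<noteq> 0"
        if k: "?nxt p < k" "k \<le> K" "?src k = var s x" "?free (?dst k)" for k
      proof (cases "k = p")
        case True
        with k(4) s''(6) w(3) show ?thesis
          by (simp add: free_neighbour_def)
      next
        case False
        with seen[OF k(1,3)] have "p < k"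
          by simp
        then have "var s' r \<noteq> 0"
          using J k by (auto simp: J_def p_def)
        with s''(6) w(3) show ?thesis
          by simp
      qed
      moreover have "?free (var s'' r)" if "var s'' r \<noteq> 0"
        using that s''(6) w(2) J by (auto simp: J_def free_neighbour_def split: if_splits)
      moreover have "clock s'' + 12 * left (?nxt p) \<le> clock s + 12 * left K + 2"
        using left_step[OF p] cl s''(5) by linarith
      ultimately show ?thesis
        using that(1) s''(1-4) nxt(1,2) p(2) J unfolding J_def by auto
    qed
    show "wp T B (Get Vw Dst Ptr ;; (Minus Dif Vw y ;; Minus Tmp y Vw ;; Plus Dif Dif Tmp) ;;
        Get Tmp Mate Vw ;; Cond Tmp Skip (Cond Dif (Plus r Vw Zer) Skip) ;; Get Ptr Nxt Ptr) J (tick s')"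
      using w y B by (auto intro!: J_next simp: vx ne simp flip: p_def split: if_splits)
  next
    fix s' assume J: "J s'" and p: "var s' Ptr = 0"
    show "Q (tick s')"
    proof (rule Q)
      show "var (tick s') r \<noteq> 0" if "?free w" for w
      proof -
        have "(var s x, w) \<in> E"
          using that by (simp add: free_neighbour_def)
        then obtain k where "k \<in> {1..K}" "?src k = var s x" "?dst k = w"
          using arcs unfolding arcs_def by auto
        then show ?thesis
          using J p that by (auto simp: J_def)
      qed
    qed (use J p in \<open>auto simp: J_def left_def\<close>)
  qed
qed

section \<open>Matchings as partner arrays and their improvement\<close>

definition mate_valid :: "(nat \<times> nat) set \<Rightarrow> (nat \<Rightarrow> nat) \<Rightarrow> bool" where
  "mate_valid E mate \<longleftrightarrow> (\<forall>u. mate u \<noteq> 0 \<longrightarrow> (u, mate u) \<in> E \<and> mate (mate u) = u)"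

definition mate_maximal :: "(nat \<times> nat) set \<Rightarrow> (nat \<Rightarrow> nat) \<Rightarrow> bool" where
  "mate_maximal E mate \<longleftrightarrow> (\<forall>(u, v) \<in> E. mate u \<noteq> 0 \<or> mate v \<noteq> 0)"

text \<open>For a matched edge \<open>(u, v)\<close> this excludes augmenting paths of length 3 with
  that edge in the middle. A single common unmatched neighbour, the triangle \<open>a = b\<close>,
  is harmless and therefore permitted.\<close>

definition unimprovable :: "(nat \<times> nat) set \<Rightarrow> (nat \<Rightarrow> nat) \<Rightarrow> nat \<Rightarrow> nat \<Rightarrow> bool" where
  "unimprovable E mate u v \<longleftrightarrow>
     (\<forall>a b. (u, a) \<in> E \<and> (v, b) \<in> E \<and> mate a = 0 \<and> mate b = 0 \<longrightarrow> a = b)"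

lemma unimprovable_sym: "unimprovable E mate u v \<Longrightarrow> unimprovable E mate v u"
  unfolding unimprovable_def by metis

text \<open>Fewer unmatched vertices mean fewer possible path ends. As augmentations only shrink the
  set of unmatched vertices, a negative inspection remains valid for good.\<close>

lemma unimprovable_antimono:
  "unimprovable E mate u v \<Longrightarrow> (\<And>w. mate' w = 0 \<Longrightarrow> mate w = 0) \<Longrightarrow> unimprovable E mate' u v"
  unfolding unimprovable_def by blast

text \<open>
  The retry handles the case where the only unmatched neighbour of \<open>Vv\<close> was taken as \<open>Va\<close>, although
  \<open>Vu\<close> has another one.
\<close>

definition find_pair :: com where
  "find_pair =
     find_free Va Vu Zer ;; find_free Vb Vv Va ;;
     Cond Vb Skip (find_free Vb Vv Zer ;; find_free Va Vu Vb)"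

text \<open>Each of the two lists is scanned at most twice at 12 ticks per arc, whence the factor
  24; the four searches have an overhead of 10 each, and the branch one tick more.\<close>

lemma wp_find_pair:
  assumes graph: "graph K E s" and E: "simple_arcs n E" and B: "2 * n \<le> B"
    and T: "clock s + 24 * (out_degree (arr s Src) K (var s Vu) + out_degree (arr s Src) K (var s Vv)) + 50 \<le> T"
    and Q: "\<And>s'. (\<And>z. z \<notin> {Va, Vb, Ptr, Vw, Tmp, Dif} \<Longrightarrow> var s' z = var s z) \<Longrightarrow>
      arr s' = arr s \<Longrightarrow> unread s' = unread s \<Longrightarrow> printed s' = printed s \<Longrightarrow>
      clock s' \<le> clock s + 24 * (out_degree (arr s Src) K (var s Vu) + out_degree (arr s Src) K (var s Vv)) + 50 \<Longrightarrow>
      (var s' Va = 0 \<or> var s' Vb = 0 \<Longrightarrow> unimprovable E (arr s Mate) (var s Vu) (var s Vv)) \<Longrightarrow>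
      (var s' Va \<noteq> 0 \<Longrightarrow> var s' Vb \<noteq> 0 \<Longrightarrow> (var s Vu, var s' Va) \<in> E \<and> (var s Vv, var s' Vb) \<in> E \<and>
         arr s Mate (var s' Va) = 0 \<and> arr s Mate (var s' Vb) = 0 \<and> var s' Va \<noteq> var s' Vb) \<Longrightarrow>
      Q s'"
  shows "wp T B find_pair Q s"
proof -
  let ?u = "var s Vu" and ?v = "var s Vv"
  let ?free = "free_neighbour E (arr s Mate)"
  let ?du = "out_degree (arr s Src) K ?u" and ?dv = "out_degree (arr s Src) K ?v"
  have range: "w \<noteq> 0 \<and> w \<le> n" if "?free x y w" for x y w
    using E that by (auto simp: free_neighbour_def simple_arcs_def)
  have pos: "w \<noteq> 0" if "(x, w) \<in> E" for x w
    using E that by (auto simp: simple_arcs_def)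
  have pair: "(x, w) \<in> E \<and> arr s Mate w = 0" if "?free x y w" for x y w
    using that by (simp add: free_neighbour_def)
  have zer: "var s Zer = 0"
    using graph by (simp add: graph_def)
  show ?thesis
    unfolding find_pair_def wp.simps(1-10)
  proof (rule wp_find_free[OF graph E B])
    fix s1 :: state assume 1: "\<And>z. z \<notin> {Va, Ptr, Vw, Tmp, Dif} \<Longrightarrow> var s1 z = var s z"
      "arr s1 = arr s" "unread s1 = unread s" "printed s1 = printed s"
      "clock s1 \<le> clock s + 12 * ?du + 10"
      "\<And>w. ?free ?u (var s Zer) w \<Longrightarrow> var s1 Va \<noteq> 0"
      "var s1 Va \<noteq> 0 \<Longrightarrow> ?free ?u (var s Zer) (var s1 Va)"
    have g1: "graph K E s1" and v1: "var s1 Vv = ?v" "var s1 Vu = ?u" "var s1 Zer = 0"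
      using graph 1(1,2) zer by (auto simp: graph_def)
    have a1: "var s1 Va \<le> n"
      using range[OF 1(7)] by (cases "var s1 Va = 0") auto
    show "wp T B (find_free Vb Vv Va)
        (\<lambda>s. if var s Vb > 0 then Q (tick s)
             else wp T B (find_free Vb Vv Zer) (wp T B (find_free Va Vu Vb) Q) (tick s)) s1"
    proof (rule wp_find_free[OF g1 E B])
      fix s2 :: state assume 2: "\<And>z. z \<notin> {Vb, Ptr, Vw, Tmp, Dif} \<Longrightarrow> var s2 z = var s1 z"
        "arr s2 = arr s1" "unread s2 = unread s1" "printed s2 = printed s1"
        "clock s2 \<le> clock s1 + 12 * out_degree (arr s1 Src) K (var s1 Vv) + 10"
        "\<And>w. free_neighbour E (arr s1 Mate) (var s1 Vv) (var s1 Va) w \<Longrightarrow> var s2 Vb \<noteq> 0"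
        "var s2 Vb \<noteq> 0 \<Longrightarrow> free_neighbour E (arr s1 Mate) (var s1 Vv) (var s1 Va) (var s2 Vb)"
      note 2 = 2[unfolded 1(2) v1]
      have g2: "graph K E (tick s2)" and v2: "var s2 Vv = ?v" "var s2 Vu = ?u" "var s2 Zer = 0"
        "var s2 Va = var s1 Va"
        using g1 2(1,2) v1 1(2) by (auto simp: graph_def)
      show "if var s2 Vb > 0 then Q (tick s2)
             else wp T B (find_free Vb Vv Zer) (wp T B (find_free Va Vu Vb) Q) (tick s2)"
      proof (cases "var s2 Vb > 0")
        case True
        have "Q (tick s2)"
        proof (rule Q)
          show "unimprovable E (arr s Mate) ?u ?v" if "var (tick s2) Va = 0 \<or> var (tick s2) Vb = 0"
          proof -
            have "var s1 Va = 0"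
              using that True v2 by simp
            then show ?thesis
              using 1(6) E unfolding unimprovable_def free_neighbour_def simple_arcs_def zer by fastforce
          qed
        next
          assume "var (tick s2) Va \<noteq> 0" "var (tick s2) Vb \<noteq> 0"
          then show "(var s Vu, var (tick s2) Va) \<in> E \<and> (var s Vv, var (tick s2) Vb) \<in> E \<and>
            arr s Mate (var (tick s2) Va) = 0 \<and> arr s Mate (var (tick s2) Vb) = 0 \<and> var (tick s2) Va \<noteq> var (tick s2) Vb"
            using 1(7) 2(7) v2 by (auto simp: free_neighbour_def)
        qed (use 1 2 in auto)
        with True show ?thesis by simp
      next
        case False
        have "wp T B (find_free Vb Vv Zer) (wp T B (find_free Va Vu Vb) Q) (tick s2)"
        proof (rule wp_find_free[OF g2 E B])
          fix s3 :: state assume 3: "\<And>z. z \<notin> {Vb, Ptr, Vw, Tmp, Dif} \<Longrightarrow> var s3 z = var (tick s2) z"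
            "arr s3 = arr (tick s2)" "unread s3 = unread (tick s2)" "printed s3 = printed (tick s2)"
            "clock s3 \<le> clock (tick s2) + 12 * out_degree (arr (tick s2) Src) K (var (tick s2) Vv) + 10"
            "\<And>w. free_neighbour E (arr (tick s2) Mate) (var (tick s2) Vv) (var (tick s2) Zer) w \<Longrightarrow> var s3 Vb \<noteq> 0"
            "var s3 Vb \<noteq> 0 \<Longrightarrow>
              free_neighbour E (arr (tick s2) Mate) (var (tick s2) Vv) (var (tick s2) Zer) (var s3 Vb)"
          note 3 = 3[simplified, unfolded 2(2) v2]
          have g3: "graph K E s3" and v3: "var s3 Vv = ?v" "var s3 Vu = ?u" "var s3 Zer = 0"
            using g2 3(1,2) v2 2(2) by (auto simp: graph_def)
          have b3: "var s3 Vb \<le> n"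
            using range[of ?v 0 "var s3 Vb"] 3(7) by (cases "var s3 Vb = 0") auto
          show "wp T B (find_free Va Vu Vb) Q s3"
          proof (rule wp_find_free[OF g3 E B])
            fix s4 :: state assume 4: "\<And>z. z \<notin> {Va, Ptr, Vw, Tmp, Dif} \<Longrightarrow> var s4 z = var s3 z"
              "arr s4 = arr s3" "unread s4 = unread s3" "printed s4 = printed s3"
              "clock s4 \<le> clock s3 + 12 * out_degree (arr s3 Src) K (var s3 Vu) + 10"
              "\<And>w. free_neighbour E (arr s3 Mate) (var s3 Vu) (var s3 Vb) w \<Longrightarrow> var s4 Va \<noteq> 0"
              "var s4 Va \<noteq> 0 \<Longrightarrow> free_neighbour E (arr s3 Mate) (var s3 Vu) (var s3 Vb) (var s4 Va)"
            note 4 = 4[unfolded 3(2) v3]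
            have v4: "var s4 Vb = var s3 Vb"
              using 4(1) by simp
            \<comment> \<open>The search excluding \<open>Va\<close> has failed, so its value is the
              only possible unmatched neighbour of \<open>Vv\<close>. If the last search fails as
              well, the same vertex is the only candidate for \<open>Vu\<close>.\<close>
            have onlya: "w = var s1 Va" if "(?v, w) \<in> E" "arr s Mate w = 0" for w
              using 2(6)[of w] that False by (auto simp: free_neighbour_def)
            show "Q s4"
            proof (rule Q)
              show "unimprovable E (arr s Mate) ?u ?v" if "var s4 Va = 0 \<or> var s4 Vb = 0"
              proof (cases "var s3 Vb = 0")
                case True
                then have "\<not> ((?v, w) \<in> E \<and> arr s Mate w = 0)" for w
                  using 3(6)[of w] pos[of ?v w] True unfolding free_neighbour_def by (metis less_irrefl_nat)
                then show ?thesis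
                  unfolding unimprovable_def by blast
              next
                case False
                then have "var s4 Va = 0"
                  using that v4 by simp
                then have "w = var s3 Vb" if "(?u, w) \<in> E" "arr s Mate w = 0" for w
                  using 4(6)[of w] that by (auto simp: free_neighbour_def)
                moreover have "var s3 Vb = var s1 Va"
                  using onlya pair[of ?v 0 "var s3 Vb"] 3(7) False by simp
                ultimately show ?thesis
                  using onlya unfolding unimprovable_def by metis
              qed
            next
              assume "var s4 Va \<noteq> 0" "var s4 Vb \<noteq> 0"
              then show "(var s Vu, var s4 Va) \<in> E \<and> (var s Vv, var s4 Vb) \<in> E \<and>
                arr s Mate (var s4 Va) = 0 \<and> arr s Mate (var s4 Vb) = 0 \<and> var s4 Va \<noteq> var s4 Vb"
                using 3(7) 4(7) v4 by (auto simp: free_neighbour_def)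
            qed (use 1 2 3 4 in auto)
          qed (use T b3 v3 1 2 3 in auto)
        qed (use T zer v2 1 2 in auto)
        with False show ?thesis by simp
      qed
    qed (use T a1 v1 1 in auto)
  qed (use T zer in auto)
qed

lemma augment_valid:
  assumes valid: "mate_valid E mate" and E: "simple_arcs n E" and uv: "mate u = v" "mate v = u"
    and ne: "u \<noteq> 0" "v \<noteq> 0" "u \<noteq> v" "a \<noteq> b" "a \<noteq> 0" "b \<noteq> 0"
    and ab: "(u, a) \<in> E" "(v, b) \<in> E" "mate a = 0" "mate b = 0"
  shows "mate_valid E (mate(u := a, a := u, v := b, b := v))"
proof -
  have "a \<noteq> u" "a \<noteq> v" "b \<noteq> u" "b \<noteq> v"
    using assms by auto
  moreover have "(a, u) \<in> E" "(b, v) \<in> E"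
    using ab E by (auto simp: simple_arcs_def dest: symD)
  \<comment> \<open>Partnership is mutual: a vertex pointing to one of the four is the old partner
    of that vertex, hence \<open>v\<close>, \<open>u\<close> or 0, and all of these are
    excluded.\<close>
  moreover have "mate w \<noteq> u \<and> mate w \<noteq> v \<and> mate w \<noteq> a \<and> mate w \<noteq> b"
    if "w \<notin> {u, v, a, b}" "mate w \<noteq> 0" for w
  proof -
    have w: "(w, mate w) \<in> E" "mate (mate w) = w"
      using valid that(2) unfolding mate_valid_def by auto
    then have "w \<noteq> 0"
      using E by (auto simp: simple_arcs_def)
    with w(2) that(1) uv ab(3,4) show ?thesis
      by auto
  qed
  ultimately show ?thesis
    using valid ab ne unfolding mate_valid_def by auto
qed

text \<open>\<open>S\<close> is the set of arcs already passed. Marks cover the inspected edges and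
  also the edges created by an augmentation, which contain a marked vertex; this justifies skipping
  arcs with a marked endpoint. Once \<open>S\<close> contains all arcs, every matched edge is
  unimprovable.\<close>

definition settled ::
    "(nat \<times> nat) set \<Rightarrow> (nat \<Rightarrow> nat) \<Rightarrow> (nat \<Rightarrow> nat) \<Rightarrow> (nat \<times> nat) set \<Rightarrow> bool" where
  "settled E mate marked S \<longleftrightarrow>
     (\<forall>u. mate u \<noteq> 0 \<and> (marked u \<noteq> 0 \<or> marked (mate u) \<noteq> 0 \<or> (u, mate u) \<in> S) \<longrightarrow>
        unimprovable E mate u (mate u))"

lemma settled_skip:
  assumes "settled E mate marked S" and "mate u \<noteq> v \<or> marked u \<noteq> 0 \<or> marked v \<noteq> 0"
  shows "settled E mate marked (insert (u, v) S)"
  using assms unfolding settled_def by auto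

lemma settled_mark:
  assumes "settled E mate marked S" and "mate_valid E mate" and "mate u = v" "mate v = u"
    and "unimprovable E mate u v"
  shows "settled E mate (marked(u := 1, v := 1)) (insert (u, v) S)"
  unfolding settled_def
proof (intro allI impI, elim conjE)
  fix w
  assume w: "mate w \<noteq> 0" and *: "(marked(u := 1, v := 1)) w \<noteq> 0 \<or>
    (marked(u := 1, v := 1)) (mate w) \<noteq> 0 \<or> (w, mate w) \<in> insert (u, v) S"
  show "unimprovable E mate w (mate w)"
  proof (cases "w = u \<or> w = v")
    case True
    then show ?thesis
      using assms unimprovable_sym by metis
  next
    case False
    then have "mate w \<noteq> u \<and> mate w \<noteq> v"
      using assms(2-4) w unfolding mate_valid_def by metis
    then show ?thesis
      using False * w assms(1) unfolding settled_def by auto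
  qed
qed

text \<open>
  The two new edges need not be inspected again: each has an endpoint that used to be unmatched
  and hence, by maximality, has no unmatched neighbours.
\<close>

lemma settled_augment:
  assumes set: "settled E mate marked S" and valid: "mate_valid E mate"
    and max: "mate_maximal E mate" and uv: "mate u = v" "mate v = u"
    and ne: "u \<noteq> 0" "v \<noteq> 0" "u \<noteq> v" "a \<noteq> 0" "b \<noteq> 0" "a \<noteq> b"
    and ab: "mate a = 0" "mate b = 0"
  shows "settled E (mate(u := a, a := u, v := b, b := v)) (marked(u := 1, v := 1)) (insert (u, v) S)"
    (is "settled E ?mate ?marked _")
  unfolding settled_def
proof (intro allI impI, elim conjE)
  fix w
  assume w: "?mate w \<noteq> 0" and *: "?marked w \<noteq> 0 \<or> ?marked (?mate w) \<noteq> 0 \<or> (w, ?mate w) \<in> insert (u, v) S"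
  have disj: "a \<noteq> u" "a \<noteq> v" "b \<noteq> u" "b \<noteq> v"
    using uv ab ne by auto
  have less: "mate x = 0" if "?mate x = 0" for x
    using that ne by (auto split: if_splits)
  have isolated: "unimprovable E ?mate x y" if "mate x = 0" for x y
  proof -
    have "?mate z \<noteq> 0" if "(x, z) \<in> E" for z
      using max that \<open>mate x = 0\<close> less[of z] unfolding mate_maximal_def by fastforce
    then show ?thesis
      unfolding unimprovable_def by blast
  qed
  show "unimprovable E ?mate w (?mate w)"
  proof (cases "w \<in> {u, v, a, b}")
    case True
    have eq: "?mate u = a" "?mate a = u" "?mate v = b" "?mate b = v"
      using disj ne uv by auto
    show ?thesis
      using True isolated[OF ab(1)] isolated[OF ab(2)] unimprovable_sym
      unfolding insert_iff empty_iff by (elim disjE) (auto simp only: eq)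
  next
    case False
    then have "?mate w = mate w" by simp
    moreover have "mate w \<noteq> u \<and> mate w \<noteq> v"
    proof -
      have "mate (mate w) = w"
        using valid w \<open>?mate w = mate w\<close> unfolding mate_valid_def by auto
      with False uv show ?thesis
        by auto
    qed
    ultimately have "unimprovable E mate w (mate w)"
      using False * w set unfolding settled_def by auto
    with \<open>?mate w = mate w\<close> show ?thesis
      using unimprovable_antimono less by metis
  qed
qed

lemma mate_maximal_mono:
  "mate_maximal E mate \<Longrightarrow> (\<And>w. mate' w = 0 \<Longrightarrow> mate w = 0) \<Longrightarrow> mate_maximal E mate'"
  unfolding mate_maximal_def by fastforce

section \<open>The pass over all arcs and its amortised cost\<close>

definition augment :: com where
  "augment =
     Cond Va
       (Cond Vb (Put Mate Vu Va ;; Put Mate Va Vu ;; Put Mate Vv Vb ;; Put Mate Vb Vv) Skip)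
       Skip"

text \<open>\<open>Dif\<close> accumulates the distance between \<open>Vv\<close> and the partner of
  \<open>Vu\<close> and the marks of both endpoints. It is 0 iff the arc is matched and neither
  endpoint has been marked, so one test decides whether to inspect.\<close>

definition improve :: com where
  "improve =
     Plus Cnt Arc Zer ;;
     While Cnt
       (Get Vu Src Cnt ;; Get Vv Dst Cnt ;; Get Va Mate Vu ;; dist Va Vv ;;
        Get Tmp Done Vu ;; Plus Dif Dif Tmp ;; Get Tmp Done Vv ;; Plus Dif Dif Tmp ;;
        Cond Dif Skip (Put Done Vu One ;; Put Done Vv One ;; find_pair ;; augment) ;;
        Minus Cnt Cnt One)"

text \<open>
  Both endpoints of an edge are marked when it is inspected. Scanning the adjacency lists of \<open>u\<close> and \<open>v\<close>
  is thus paid for by the arcs whose source ceases to be unmarked.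
\<close>

definition improvement_invariant :: "nat \<Rightarrow> (nat \<times> nat) set \<Rightarrow> nat \<Rightarrow> state \<Rightarrow> bool" where
  "improvement_invariant K E N s \<longleftrightarrow>
     graph K E s \<and> var s Arc = K \<and> var s Cnt \<le> K \<and> printed s = [] \<and>
     mate_valid E (arr s Mate) \<and> mate_maximal E (arr s Mate) \<and> (\<forall>u. arr s Done u \<le> 1) \<and>
     settled E (arr s Mate) (arr s Done) ((\<lambda>k. (arr s Src k, arr s Dst k)) ` {var s Cnt<..K}) \<and>
     clock s + 100 * var s Cnt + 24 * card {k \<in> {1..K}. arr s Done (arr s Src k) = 0} \<le> N"

lemma improvement_step:
  assumes J: "improvement_invariant K E N s" and pos: "var s Cnt > 0"
    and E: "simple_arcs n E" and B: "2 * n + 2 \<le> B" and N: "N \<le> T"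
  shows "wp T B
     (Get Vu Src Cnt ;; Get Vv Dst Cnt ;; Get Va Mate Vu ;; dist Va Vv ;;
      Get Tmp Done Vu ;; Plus Dif Dif Tmp ;; Get Tmp Done Vv ;; Plus Dif Dif Tmp ;;
      Cond Dif Skip (Put Done Vu One ;; Put Done Vv One ;; find_pair ;; augment) ;;
      Minus Cnt Cnt One) (improvement_invariant K E N) (tick s)"
proof -
  define i where "i = var s Cnt"
  define u where "u = arr s Src i"
  define v where "v = arr s Dst i"
  define S where "S = (\<lambda>k. (arr s Src k, arr s Dst k)) ` {i<..K}"
  let ?mate = "arr s Mate" and ?done = "arr s Done"
  have graph: "graph K E s" and arcs: "arcs (arr s Src) (arr s Dst) K = E"
    and one: "var s One = 1" "var s Zer = 0" and arc: "var s Arc = K" and i: "1 \<le> i" "i \<le> K"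
    and pr: "printed s = []" and valid: "mate_valid E ?mate" and max: "mate_maximal E ?mate"
    and d1: "\<And>u. ?done u \<le> 1" and set: "settled E ?mate ?done S"
    and clk: "clock s + 100 * i + 24 * card {k \<in> {1..K}. ?done (arr s Src k) = 0} \<le> N"
    using J pos by (auto simp: improvement_invariant_def graph_def i_def S_def)
  have uv: "(u, v) \<in> E"
    using i arcs by (auto simp: arcs_def u_def v_def)
  then have ne: "u \<noteq> 0" "v \<noteq> 0" "u \<noteq> v" and le: "u \<le> n" "v \<le> n"
    using E by (auto simp: simple_arcs_def)
  have mate_le: "?mate w \<le> n" for w
    using valid E by (cases "?mate w = 0") (auto simp: mate_valid_def simple_arcs_def)
  have S': "(\<lambda>k. (arr s Src k, arr s Dst k)) ` {i - 1<..K} = insert (u, v) S"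
  proof -
    have "{i - 1<..K} = insert i {i<..K}"
      using i by auto
    then show ?thesis
      by (simp add: S_def u_def v_def)
  qed
  have clk': "clock s + 100 + 100 * (i - 1) + 24 * card {k \<in> {1..K}. ?done (arr s Src k) = 0} \<le> N"
    and i': "i - 1 \<le> K"
    using clk i by linarith+
  define treat where "treat =
    Cond Dif Skip (Put Done Vu One ;; Put Done Vv One ;; find_pair ;; augment)"
  have treat: "wp T B treat (wp T B (Minus Cnt Cnt One) (improvement_invariant K E N)) s1"
    if s1: "\<And>z. z \<notin> {Vu, Vv, Va, Dif, Tmp} \<Longrightarrow> var s1 z = var s z" "arr s1 = arr s"
      "printed s1 = printed s" "var s1 Vu = u" "var s1 Vv = v" "clock s1 \<le> clock s + 20"
      "var s1 Dif = 0 \<longleftrightarrow> ?mate u = v \<and> ?done u = 0 \<and> ?done v = 0"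
    for s1 :: state
  proof (cases "var s1 Dif = 0")
    case False
    then have "settled E ?mate ?done (insert (u, v) S)"
      using settled_skip[OF set, of u v] s1(7) by metis
    then show ?thesis
      using False s1(1-6) graph arc i' pr valid max d1 clk' one
      by (simp add: treat_def improvement_invariant_def graph_def S'[unfolded One_nat_def] flip: i_def)
  next
    case True
    then have free: "?mate u = v" "?done u = 0" "?done v = 0" and "?mate v = u"
      using s1(7) valid ne by (auto simp: mate_valid_def)
    let ?done' = "?done(u := 1, v := 1)"
    define du where "du = out_degree (arr s Src) K u"
    define dv where "dv = out_degree (arr s Src) K v"
    \<comment> \<open>The arcs leaving \<open>u\<close> or \<open>v\<close> are exactly those whose
      source loses its unmarked status; the two groups are disjoint because
      \<open>u \<noteq> v\<close>.\<close>
    have pay: "card {k \<in> {1..K}. ?done' (arr s Src k) = 0} + (du + dv)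
        = card {k \<in> {1..K}. ?done (arr s Src k) = 0}"
    proof -
      let ?R = "{k \<in> {1..K}. ?done' (arr s Src k) = 0}"
        and ?U = "{k \<in> {1..K}. arr s Src k = u}" and ?V = "{k \<in> {1..K}. arr s Src k = v}"
      have "?R \<inter> (?U \<union> ?V) = {}" "?U \<inter> ?V = {}"
        using ne by auto
      then have "card (?R \<union> (?U \<union> ?V)) = card ?R + (card ?U + card ?V)"
        by (simp add: card_Un_disjoint)
      moreover have "{k \<in> {1..K}. ?done (arr s Src k) = 0} = ?R \<union> (?U \<union> ?V)"
        using free by auto
      ultimately show ?thesis
        by (simp add: du_def dv_def out_degree_def)
    qed
    define s2 where "s2 = set_arr Done v 1 (set_arr Done u 1 (tick s1))"
    have s2: "var s2 = var s1" "arr s2 = (arr s)(Done := ?done')" "printed s2 = []"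
      "clock s2 = clock s1 + 3"
      using s1(2,3) pr by (simp_all add: s2_def)
    have "wp T B find_pair (wp T B augment (wp T B (Minus Cnt Cnt One) (improvement_invariant K E N))) s2"
    proof (rule wp_find_pair[where K = K and E = E and n = n])
      show "graph K E s2"
        using graph s2(1,2) s1(1) by (simp add: graph_def)
      show "clock s2 + 24 * (out_degree (arr s2 Src) K (var s2 Vu) +
          out_degree (arr s2 Src) K (var s2 Vv)) + 50 \<le> T"
        using s2 s1 clk pay N i by (simp add: du_def dv_def)
    next
      fix s3 :: state
      assume 3: "\<And>z. z \<notin> {Va, Vb, Ptr, Vw, Tmp, Dif} \<Longrightarrow> var s3 z = var s2 z"
        "arr s3 = arr s2" "printed s3 = printed s2"
        "clock s3 \<le> clock s2 + 24 * (out_degree (arr s2 Src) K (var s2 Vu) +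
          out_degree (arr s2 Src) K (var s2 Vv)) + 50"
        "var s3 Va = 0 \<or> var s3 Vb = 0 \<Longrightarrow> unimprovable E (arr s2 Mate) (var s2 Vu) (var s2 Vv)"
        "var s3 Va \<noteq> 0 \<Longrightarrow> var s3 Vb \<noteq> 0 \<Longrightarrow>
          (var s2 Vu, var s3 Va) \<in> E \<and> (var s2 Vv, var s3 Vb) \<in> E \<and>
          arr s2 Mate (var s3 Va) = 0 \<and> arr s2 Mate (var s3 Vb) = 0 \<and> var s3 Va \<noteq> var s3 Vb"
      have v3: "var s3 Vu = u" "var s3 Vv = v" "var s3 Cnt = i" "var s3 One = 1" "var s3 Zer = 0"
        "var s3 Arc = K"
        using 3(1) s2(1) s1(1,4,5) one arc by (simp_all add: i_def)
      \<comment> \<open>Apart from the scans, at most 20 + 3 + 50 of the 100 ticks allotted to the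
        arc are spent so far; 20 more are set aside for \<open>augment\<close> and the
        decrement.\<close>
      have clk3: "clock s3 + 20 + 100 * (i - 1) + 24 * card {k \<in> {1..K}. ?done' (arr s Src k) = 0} \<le> N"
      proof -
        have "clock s3 \<le> clock s + 73 + 24 * (du + dv)"
          using 3(4) s2 s1(4,5,6) by (simp add: du_def dv_def)
        moreover have "x + 20 + 100 * (i - 1) + 24 * c' \<le> N"
          if "x \<le> y + 73 + 24 * d" "y + 100 + 100 * (i - 1) + 24 * c \<le> N" "c' + d = c" for x y c c' d
          using that by simp
        ultimately show ?thesis
          using clk' pay by blast
      qed
      have adj: "adjacency (arr s Src) (arr s Nxt) (arr s Head) K"
        using graph by (simp add: graph_def)
      have d1': "?done' w \<le> 1" for w
        using d1 by simp
      show "wp T B augment (wp T B (Minus Cnt Cnt One) (improvement_invariant K E N)) s3"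
      proof (cases "var s3 Va = 0 \<or> var s3 Vb = 0")
        case True
        then have "settled E ?mate ?done' (insert (u, v) S)"
          using settled_mark[OF set valid free(1) \<open>?mate v = u\<close>] 3(5) s2 s1(4,5) by simp
        then show ?thesis
          using True i valid max clk3 d1' adj arcs v3 3(2,3) s2(2,3)
          by (auto simp: augment_def improvement_invariant_def graph_def S'[unfolded One_nat_def])
      next
        case False
        define a where "a = var s3 Va"
        define b where "b = var s3 Vb"
        have ab: "(u, a) \<in> E" "(v, b) \<in> E" "?mate a = 0" "?mate b = 0" "a \<noteq> b" "a \<noteq> 0" "b \<noteq> 0"
          using False 3(6) s2 s1(4,5) by (auto simp: a_def b_def)
        let ?mate' = "?mate(u := a, a := u, v := b, b := v)"
        have "mate_valid E ?mate'"
          using augment_valid[OF valid E] free(1) \<open>?mate v = u\<close> ne ab by blast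
        moreover have "mate_maximal E ?mate'"
          using ne ab by (intro mate_maximal_mono[OF max]) (auto split: if_splits)
        moreover have "settled E ?mate' ?done' (insert (u, v) S)"
          using settled_augment[OF set valid max free(1) \<open>?mate v = u\<close>] ne ab by blast
        ultimately show ?thesis
          using False i clk3 d1' adj arcs v3 3(2,3) s2(2,3) ab(6,7)
          by (simp add: augment_def improvement_invariant_def graph_def S'[unfolded One_nat_def] flip: a_def b_def)
      qed
    qed (use E B in auto)
    then show ?thesis
      using True s1(1,4,5) one by (simp add: treat_def s2_def)
  qed
  have "max (?mate u) v \<le> n"
    using mate_le le by simp
  \<comment> \<open>Two truncated differences of at most \<open>n\<close> and two marks of at most 1
    explain the value bound \<open>2 * n + 2\<close>.\<close>
  then have bound: "?mate u - v + (v - ?mate u) + ?done u + ?done v \<le> B"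
    "?mate u - v + (v - ?mate u) + ?done u \<le> B" "?mate u - v + (v - ?mate u) \<le> B"
    using B d1[of u] d1[of v] by linarith+
  show ?thesis
    unfolding treat_def[symmetric] wp.simps(9)[of _ _ treat]
    using bound
    by (auto intro!: treat simp: dist_def u_def v_def i_def split: if_splits)
qed

text \<open>Initially no source is marked, so each of the \<open>K\<close> arcs contributes 100 for
  its own turn and 24 towards scans. The additional 2 ticks are the first assignment and the final
  loop test.\<close>

lemma wp_improve:
  assumes graph: "graph K E s" and arc: "var s Arc = K" and pr: "printed s = []"
    and valid: "mate_valid E (arr s Mate)" and max: "mate_maximal E (arr s Mate)"
    and unmarked: "arr s Done = (\<lambda>_. 0)"
    and E: "simple_arcs n E" and B: "2 * n + 2 \<le> B" "K \<le> B" and T: "clock s + 124 * K + 2 \<le> T"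
    and Q: "\<And>s'. graph K E s' \<Longrightarrow> var s' Arc = K \<Longrightarrow> printed s' = [] \<Longrightarrow>
      mate_valid E (arr s' Mate) \<Longrightarrow> mate_maximal E (arr s' Mate) \<Longrightarrow>
      (\<And>u. arr s' Mate u \<noteq> 0 \<Longrightarrow> unimprovable E (arr s' Mate) u (arr s' Mate u)) \<Longrightarrow>
      clock s' \<le> clock s + 124 * K + 2 \<Longrightarrow> Q s'"
  shows "wp T B improve Q s"
proof -
  define N where "N = clock s + 124 * K + 1"
  have zer: "var s Zer = 0"
    using graph by (simp add: graph_def)
  have card: "card {k \<in> {1..K}. P k} \<le> K" for P
  proof -
    have "{k \<in> {1..K}. P k} \<subseteq> {1..K}"
      by auto
    then show ?thesis
      using card_mono[of "{1..K}"] by fastforce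
  qed
  let ?s = "set_var Cnt (var s Arc + var s Zer) s"
  show ?thesis
    unfolding improve_def wp.simps(9)[of T B "Plus Cnt Arc Zer"] wp.simps(3)
  proof (rule conjI, use arc zer B in simp, rule wp_While[where J = "improvement_invariant K E N"])
    show "improvement_invariant K E N ?s"
      using assms(1-6) card[of "\<lambda>_. True"]
      by (auto simp: improvement_invariant_def graph_def settled_def N_def)
  next
    fix s' assume "improvement_invariant K E N s'"
    then show "clock s' \<le> T"
      using T by (simp add: improvement_invariant_def N_def)
  next
    fix s' assume J: "improvement_invariant K E N s'" and "var s' Cnt = 0"
    moreover have "{0<..K} = {1..K}"
      by auto
    ultimately have "settled E (arr s' Mate) (arr s' Done) E"
      by (auto simp: improvement_invariant_def graph_def arcs_def)
    then have "unimprovable E (arr s' Mate) u (arr s' Mate u)" if "arr s' Mate u \<noteq> 0" for u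
      using that J unfolding settled_def improvement_invariant_def mate_valid_def by blast
    then show "Q (tick s')"
      using J by (intro Q) (auto simp: improvement_invariant_def graph_def N_def)
  next
    fix s' assume "improvement_invariant K E N s'" "0 < var s' Cnt"
    then show "wp T B (Get Vu Src Cnt ;; Get Vv Dst Cnt ;; Get Va Mate Vu ;; dist Va Vv ;;
        Get Tmp Done Vu ;; Plus Dif Dif Tmp ;; Get Tmp Done Vv ;; Plus Dif Dif Tmp ;;
        Cond Dif Skip (Put Done Vu One ;; Put Done Vv One ;; find_pair ;; augment) ;;
        Minus Cnt Cnt One) (improvement_invariant K E N) (tick s')"
      using E B T by (intro improvement_step) (auto simp: N_def)
  qed
qed

section \<open>Reading the graph and printing the matching\<close>

definition matched_edges :: "(nat \<Rightarrow> nat) \<Rightarrow> nat set set" where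
  "matched_edges mate = (\<lambda>u. {u - 1, mate u - 1}) ` {u. mate u \<noteq> 0}"

lemma mate_valid_pos:
  assumes "mate_valid E mate" and "simple_arcs n E" and "mate u \<noteq> 0"
  shows "u \<noteq> 0" "u \<le> n" "mate u \<le> n" "u \<noteq> mate u" "mate (mate u) = u"
proof -
  have "(u, mate u) \<in> E"
    using assms(1,3) unfolding mate_valid_def by blast
  with assms(2) have "u \<noteq> mate u \<and> 0 < u \<and> u \<le> n \<and> mate u \<le> n"
    unfolding simple_arcs_def by fast
  then show "u \<noteq> 0" "u \<le> n" "mate u \<le> n" "u \<noteq> mate u"
    by simp_all
  show "mate (mate u) = u"
    using assms(1,3) unfolding mate_valid_def by blast
qed

lemma finite_matched_edges:
  assumes "mate_valid E mate" and "simple_arcs n E"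
  shows "finite (matched_edges mate)"
  unfolding matched_edges_def
proof (intro finite_imageI)
  show "finite {u. mate u \<noteq> 0}"
    using mate_valid_pos(2)[OF assms] by (auto intro: finite_subset[OF _ finite_atMost[of n]])
qed

lemma matched_edges_iff:
  assumes "mate_valid E mate" and "simple_arcs n E"
  shows "{a, b} \<in> matched_edges mate \<longleftrightarrow> mate (Suc a) = Suc b"
proof
  assume "{a, b} \<in> matched_edges mate"
  then obtain u where u: "mate u \<noteq> 0" "{a, b} = {u - 1, mate u - 1}"
    by (auto simp: matched_edges_def)
  note pos = mate_valid_pos[OF assms u(1)]
  obtain w where "u = Suc w" using pos(1) by (cases u) auto
  with u pos show "mate (Suc a) = Suc b"
    by (auto simp: doubleton_eq_iff)
next
  assume "mate (Suc a) = Suc b"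
  then show "{a, b} \<in> matched_edges mate"
    unfolding matched_edges_def by (intro image_eqI[of _ _ "Suc a"]) simp_all
qed

text \<open>An edge arises from both of its endpoints, so both entries must be cleared to delete it.
  That it is then absent lets the printed edges be counted without repetition.\<close>

lemma matched_edges_remove:
  assumes valid: "mate_valid E mate" and E: "simple_arcs n E" and uv: "mate u = v" "v \<noteq> 0"
  shows "mate_valid E (mate(u := 0, v := 0))"
    and "matched_edges mate = insert {u - 1, v - 1} (matched_edges (mate(u := 0, v := 0)))"
    and "{u - 1, v - 1} \<notin> matched_edges (mate(u := 0, v := 0))"
proof -
  note pos = mate_valid_pos[OF valid E, of u, unfolded uv]
  have other: "mate w \<noteq> u \<and> mate w \<noteq> v" if "mate w \<noteq> 0" "w \<noteq> u" "w \<noteq> v" for w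
    using mate_valid_pos(5)[OF valid E that(1)] that uv pos(5) by auto
  then show valid': "mate_valid E (mate(u := 0, v := 0))"
    using valid unfolding mate_valid_def by auto
  have "{w. mate w \<noteq> 0} = insert u (insert v {w. (mate(u := 0, v := 0)) w \<noteq> 0})"
    using uv pos by auto
  then have "matched_edges mate = insert {u - 1, v - 1} (insert {v - 1, mate v - 1}
      ((\<lambda>w. {w - 1, mate w - 1}) ` {w. (mate(u := 0, v := 0)) w \<noteq> 0}))"
    using uv by (simp add: matched_edges_def)
  also have "(\<lambda>w. {w - 1, mate w - 1}) ` {w. (mate(u := 0, v := 0)) w \<noteq> 0} =
      matched_edges (mate(u := 0, v := 0))"
    unfolding matched_edges_def by (intro image_cong) (auto split: if_splits)
  finally show "matched_edges mate = insert {u - 1, v - 1} (matched_edges (mate(u := 0, v := 0)))"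
    using pos(5)[OF uv(2)] by (simp add: insert_commute)
  obtain a where "u = Suc a"
    using pos(1)[OF uv(2)] by (cases u) auto
  then show "{u - 1, v - 1} \<notin> matched_edges (mate(u := 0, v := 0))"
    using matched_edges_iff[OF valid' E, of a "v - 1"] by simp
qed

text \<open>Unmatching a printed edge prevents its reversed arc from printing it again.\<close>

definition print_matching :: com where
  "print_matching =
     While Arc
       (Get Vu Src Arc ;; Get Vv Dst Arc ;; Get Va Mate Vu ;; dist Va Vv ;;
        Cond Dif Skip
          (Put Mate Vu Zer ;; Put Mate Vv Zer ;; Minus Vu Vu One ;; Output Vu ;;
           Minus Vv Vv One ;; Output Vv) ;;
        Minus Arc Arc One)"

lemma flatten_snoc: "flatten (L @ [(u, v)]) = flatten L @ [u, v]"
  by (simp add: flatten_def)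

lemma wp_print_matching:
  assumes graph: "graph K E s" and arc: "var s Arc = K" and pr: "printed s = []"
    and valid: "mate_valid E (arr s Mate)" and E: "simple_arcs n E"
    and B: "2 * n \<le> B" and T: "clock s + 20 * K + 1 \<le> T"
    and Q: "\<And>s' L. printed s' = flatten L \<Longrightarrow> edge_listing L (matched_edges (arr s Mate)) \<Longrightarrow>
      clock s' \<le> clock s + 20 * K + 1 \<Longrightarrow> Q s'"
  shows "wp T B print_matching Q s"
proof -
  let ?src = "arr s Src" and ?dst = "arr s Dst" and ?M = "matched_edges (arr s Mate)"
  \<comment> \<open>The edges printed and those left in \<open>Mate\<close> make up the original
    matching, and their numbers add up to its cardinality, so nothing is printed twice. Moreover, no
    arc that has been passed is still matched.\<close>
  define J where "J s' \<longleftrightarrow>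
      arr s' Src = ?src \<and> arr s' Dst = ?dst \<and> var s' Zer = 0 \<and> var s' One = 1 \<and> var s' Arc \<le> K \<and>
      mate_valid E (arr s' Mate) \<and>
      (\<forall>k. var s' Arc < k \<and> k \<le> K \<and> arr s' Mate (?src k) \<noteq> 0 \<longrightarrow> arr s' Mate (?src k) \<noteq> ?dst k) \<and>
      (\<exists>L. printed s' = flatten L \<and>
        (\<lambda>(u, v). {u, v}) ` set L \<union> matched_edges (arr s' Mate) = ?M \<and>
        length L + card (matched_edges (arr s' Mate)) = card ?M) \<and>
      clock s' + 20 * var s' Arc \<le> clock s + 20 * K" for s' :: state
  have arcs: "arcs ?src ?dst K = E"
    using graph by (simp add: graph_def)
  show ?thesis
    unfolding print_matching_def
  proof (rule wp_While[where J = J])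
    show "J s"
      using graph arc pr valid by (auto simp: J_def graph_def flatten_def)
  next
    fix s' assume "J s'"
    then show "clock s' \<le> T"
      using T by (simp add: J_def)
  next
    fix s' assume J: "J s'" and "0 < var s' Arc"
    then obtain i where i: "var s' Arc = Suc i"
      by (cases "var s' Arc") auto
    define u where "u = ?src (Suc i)"
    define v where "v = ?dst (Suc i)"
    let ?mate = "arr s' Mate"
    have "(u, v) \<in> E"
      using J i arcs by (force simp: J_def arcs_def u_def v_def)
    then have ne: "u \<noteq> 0" "v \<noteq> 0" "u \<noteq> v" "v \<le> n"
      using E by (auto simp: simple_arcs_def)
    have valid': "mate_valid E ?mate"
      using J by (simp add: J_def)
    have "?mate u \<le> n"
      using mate_valid_pos(3)[OF valid' E, of u] by (cases "?mate u = 0") auto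
    then have "?mate u - v + (v - ?mate u) \<le> B"
      using ne(4) B by linarith
    have seen: "k = Suc i \<or> Suc i < k" if "i < k" for k
      using that by linarith
    obtain L where L: "printed s' = flatten L"
        "(\<lambda>(u, v). {u, v}) ` set L \<union> matched_edges ?mate = ?M"
        "length L + card (matched_edges ?mate) = card ?M"
      using J by (auto simp: J_def)
    have skip: "J s''" if "?mate u \<noteq> v" "var s'' Arc = i" "arr s'' = arr s'"
      "var s'' Zer = 0" "var s'' One = 1" "printed s'' = printed s'" "clock s'' \<le> clock s' + 20"
      for s'' :: state
      using J that seen i by (fastforce simp: J_def u_def v_def)
    have remove: "J s''"
      if uv: "?mate u = v" and s'': "var s'' Arc = i"
        "arr s'' = (arr s')(Mate := ?mate(u := 0, v := 0))"
        "var s'' Zer = 0" "var s'' One = 1" "printed s'' = printed s' @ [u - 1, v - 1]"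
        "clock s'' \<le> clock s' + 20"
      for s'' :: state
    proof -
      note rem = matched_edges_remove[OF valid' E uv ne(2)]
      have "\<exists>L. printed s'' = flatten L \<and>
        (\<lambda>(u, v). {u, v}) ` set L \<union> matched_edges (arr s'' Mate) = ?M \<and>
        length L + card (matched_edges (arr s'' Mate)) = card ?M"
      proof (intro exI conjI)
        show "printed s'' = flatten (L @ [(u - 1, v - 1)])"
          using L(1) s''(5) by (simp add: flatten_snoc)
        show "(\<lambda>(u, v). {u, v}) ` set (L @ [(u - 1, v - 1)]) \<union> matched_edges (arr s'' Mate) = ?M"
          using L(2) rem(2) s''(2) by simp
        show "length (L @ [(u - 1, v - 1)]) + card (matched_edges (arr s'' Mate)) = card ?M"
          using L(3) rem(2,3) finite_matched_edges[OF rem(1) E] s''(2) by simp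
      qed
      moreover have "arr s'' Mate (?src k) \<noteq> ?dst k"
        if k: "i < k" "k \<le> K" "arr s'' Mate (?src k) \<noteq> 0" for k
      proof (cases "k = Suc i")
        case True
        then show ?thesis
          using k s''(2) by (auto simp: u_def split: if_splits)
      next
        case False
        then have "Suc i < k" "?mate (?src k) \<noteq> 0"
          using k s''(2) by (auto split: if_splits)
        then have "?mate (?src k) \<noteq> ?dst k"
          using J k i by (auto simp: J_def)
        then show ?thesis
          using k s''(2) by (auto split: if_splits)
      qed
      ultimately show ?thesis
        using J i s'' rem(1) unfolding J_def by auto
    qed
    have zo: "var s' One = 1" "var s' Zer = 0" "arr s' Src = ?src" "arr s' Dst = ?dst"
      using J by (auto simp: J_def)
    show "wp T B
        (Get Vu Src Arc ;; Get Vv Dst Arc ;; Get Va Mate Vu ;; dist Va Vv ;;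
         Cond Dif Skip
           (Put Mate Vu Zer ;; Put Mate Vv Zer ;; Minus Vu Vu One ;; Output Vu ;;
            Minus Vv Vv One ;; Output Vv) ;;
         Minus Arc Arc One) J (tick s')"
    proof (cases "?mate u = v")
      case True
      with zo i show ?thesis
        by (auto intro!: remove simp: dist_def simp flip: u_def v_def)
    next
      case False
      with \<open>?mate u - v + (v - ?mate u) \<le> B\<close> zo i show ?thesis
        by (auto intro!: skip simp: dist_def simp flip: u_def v_def)
    qed
  next
    fix s' assume J: "J s'" and "var s' Arc = 0"
    have valid': "mate_valid E (arr s' Mate)"
      using J by (simp add: J_def)
    \<comment> \<open>A remaining partner would belong to some arc of \<open>E\<close>; but all arcs
      have been passed, and none of them is matched any more.\<close>
    have "arr s' Mate u = 0" for u
    proof (rule ccontr)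
      assume *: "arr s' Mate u \<noteq> 0"
      then have "(u, arr s' Mate u) \<in> E"
        using valid' by (simp add: mate_valid_def)
      then obtain k where "k \<in> {1..K}" and k': "?src k = u" "?dst k = arr s' Mate u"
        using arcs unfolding arcs_def by auto
      then have k: "0 < k" "k \<le> K"
        by simp_all
      have "arr s' Mate (?src k) \<noteq> 0 \<longrightarrow> arr s' Mate (?src k) \<noteq> ?dst k"
        using J k(1,2) \<open>var s' Arc = 0\<close> unfolding J_def by simp
      then show False
        using k' * by simp
    qed
    then have "matched_edges (arr s' Mate) = {}"
      by (simp add: matched_edges_def)
    then show "Q (tick s')"
    proof -
      assume "matched_edges (arr s' Mate) = {}"
      then obtain L where "printed s' = flatten L" "(\<lambda>(u, v). {u, v}) ` set L = ?M" "length L = card ?M"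
        using J unfolding J_def by auto
      moreover have "clock s' \<le> clock s + 20 * K"
        using J by (simp add: J_def)
      ultimately show ?thesis
        by (intro Q[of _ L]) (simp_all add: edge_listing_def)
    qed
  qed
qed

section \<open>Reading the edges while building a greedy maximal matching\<close>

definition read_edges :: com where
  "read_edges =
     While Cnt
       (Input Vu ;; Plus Vu Vu One ;; Input Vv ;; Plus Vv Vv One ;;
        push Vu Vv ;; push Vv Vu ;;
        Get Va Mate Vu ;; Get Vb Mate Vv ;; Plus Va Va Vb ;;
        Cond Va Skip (Put Mate Vu Vv ;; Put Mate Vv Vu) ;;
        Minus Cnt Cnt One)"

definition arcs_of :: "(nat \<times> nat) list \<Rightarrow> (nat \<times> nat) set" where
  "arcs_of es = (\<Union>(u, v) \<in> set es. {(Suc u, Suc v), (Suc v, Suc u)})"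

lemma mate_valid_mono: "mate_valid E mate \<Longrightarrow> E \<subseteq> E' \<Longrightarrow> mate_valid E' mate"
  unfolding mate_valid_def by blast

lemma greedy_add:
  assumes "mate_valid E mate" and "simple_arcs n E" and "mate u = 0" "mate v = 0"
    and ne: "u \<noteq> 0" "v \<noteq> 0" "u \<noteq> v"
  shows "mate_valid (insert (v, u) (insert (u, v) E)) (mate(u := v, v := u))"
proof -
  have "mate w \<noteq> u \<and> mate w \<noteq> v \<and> (w, mate w) \<in> E \<and> mate (mate w) = w" if "mate w \<noteq> 0" for w
    using mate_valid_pos(1,5)[OF assms(1,2) that] assms(1,3,4) that unfolding mate_valid_def by auto
  then show ?thesis
    using ne unfolding mate_valid_def by auto
qed

lemma mate_maximal_insert:
  "mate_maximal E mate \<Longrightarrow> mate u \<noteq> 0 \<or> mate v \<noteq> 0 \<Longrightarrow>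
    mate_maximal (insert (v, u) (insert (u, v) E)) mate"
  unfolding mate_maximal_def by blast

lemma simple_arcs_insert:
  "simple_arcs n E \<Longrightarrow> u \<noteq> v \<Longrightarrow> 0 < u \<Longrightarrow> u \<le> n \<Longrightarrow> 0 < v \<Longrightarrow> v \<le> n \<Longrightarrow>
    simple_arcs n (insert (v, u) (insert (u, v) E))"
  unfolding simple_arcs_def sym_def by blast

text \<open>As an equation between predicates it also rewrites inside postconditions that are not
  applied to a state.\<close>

lemma wp_Seq: "wp T B (c ;; d) Q = wp T B c (wp T B d Q)"
  by (rule ext) simp

lemma wp_read_edges:
  assumes s: "unread s = flatten es" "var s Cnt = length es" "var s One = 1" "var s Zer = 0"
      "var s Arc = 0" "arr s = (\<lambda>_ _. 0)" "printed s = []"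
    and es: "\<forall>(u, v) \<in> set es. u < n \<and> v < n \<and> u \<noteq> v"
    and B: "2 * n \<le> B" "2 * length es \<le> B" and T: "clock s + 40 * length es + 1 \<le> T"
    and Q: "\<And>s'. graph (2 * length es) (arcs_of es) s' \<Longrightarrow> var s' Arc = 2 * length es \<Longrightarrow>
      simple_arcs n (arcs_of es) \<Longrightarrow>
      mate_valid (arcs_of es) (arr s' Mate) \<Longrightarrow> mate_maximal (arcs_of es) (arr s' Mate) \<Longrightarrow>
      arr s' Done = (\<lambda>_. 0) \<Longrightarrow> printed s' = [] \<Longrightarrow>
      clock s' \<le> clock s + 40 * length es + 1 \<Longrightarrow> Q s'"
  shows "wp T B read_edges Q s"
proof -
  \<comment> \<open>\<open>rest\<close> holds the edges not yet read and \<open>E\<close> the arcs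
    inserted so far. The matching is valid and maximal for \<open>E\<close> alone, so it is maximal
    for the whole graph once \<open>rest\<close> is empty.\<close>
  define J where "J s' \<longleftrightarrow> (\<exists>rest E. unread s' = flatten rest \<and> set rest \<subseteq> set es \<and>
      var s' Cnt = length rest \<and> graph (var s' Arc) E s' \<and>
      var s' Arc + 2 * length rest = 2 * length es \<and> simple_arcs n E \<and>
      E \<union> arcs_of rest = arcs_of es \<and> mate_valid E (arr s' Mate) \<and> mate_maximal E (arr s' Mate) \<and>
      arr s' Done = (\<lambda>_. 0) \<and> printed s' = [] \<and>
      clock s' + 40 * length rest \<le> clock s + 40 * length es)" for s' :: state
  show ?thesis
    unfolding read_edges_def
  proof (rule wp_While[where J = J])
    have "graph 0 {} s" "mate_valid {} (arr s Mate)" "mate_maximal {} (arr s Mate)" "simple_arcs n {}"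
      using s by (auto simp: graph_def adjacency_def arcs_def mate_valid_def mate_maximal_def
          simple_arcs_def)
    then show "J s"
      unfolding J_def using s by (intro exI[of _ es] exI[of _ "{}"]) simp
  next
    fix s' assume "J s'"
    then show "clock s' \<le> T"
      using T by (auto simp: J_def)
  next
    fix s' assume "J s'" "var s' Cnt = 0"
    then obtain E where *: "graph (var s' Arc) E s'" "var s' Arc = 2 * length es" "simple_arcs n E"
      "E \<union> arcs_of [] = arcs_of es" "mate_valid E (arr s' Mate)" "mate_maximal E (arr s' Mate)"
      "arr s' Done = (\<lambda>_. 0)" "printed s' = []" "clock s' \<le> clock s + 40 * length es"
      unfolding J_def by fastforce
    then have "E = arcs_of es"
      by (simp add: arcs_of_def)
    with * show "Q (tick s')"
      by (intro Q) (simp_all add: graph_def)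
  next
    fix s' assume J: "J s'" and "0 < var s' Cnt"
    then obtain rest' E where *: "unread s' = flatten rest'" "set rest' \<subseteq> set es"
      "var s' Cnt = length rest'" "graph (var s' Arc) E s'"
      "var s' Arc + 2 * length rest' = 2 * length es" "simple_arcs n E"
      "E \<union> arcs_of rest' = arcs_of es" "mate_valid E (arr s' Mate)" "mate_maximal E (arr s' Mate)"
      "arr s' Done = (\<lambda>_. 0)" "printed s' = []"
      "clock s' + 40 * length rest' \<le> clock s + 40 * length es"
      unfolding J_def by blast
    with \<open>0 < var s' Cnt\<close> obtain x y rest where rest': "rest' = (x, y) # rest"
      by (cases rest') auto
    define u where "u = Suc x"
    define v where "v = Suc y"
    have xy: "x < n" "y < n" "x \<noteq> y"
      using es *(2) rest' by auto
    then have uv: "u \<noteq> v" "0 < u" "u \<le> n" "0 < v" "v \<le> n"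
      by (auto simp: u_def v_def)
    define E' where "E' = insert (v, u) (insert (u, v) E)"
    define K where "K = var s' Arc"
    have K: "Suc (Suc K) + 2 * length rest = 2 * length es"
      using *(5) rest' by (simp add: K_def)
    have "arcs_of rest' = insert (v, u) (insert (u, v) (arcs_of rest))"
      unfolding rest' arcs_of_def u_def v_def by auto
    then have "E' \<union> arcs_of rest = E \<union> arcs_of rest'"
      unfolding E'_def by blast
    with *(7) have E': "simple_arcs n E'" "E' \<union> arcs_of rest = arcs_of es"
      using simple_arcs_insert[OF *(6) uv] by (simp_all add: E'_def)
    have one: "var s' One = 1" "var s' Zer = 0"
      using *(4) by (auto simp: graph_def)
    have mate_le: "arr s' Mate w \<le> n" for w
      using mate_valid_pos(3)[OF *(8,6), of w] by (cases "arr s' Mate w = 0") auto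
    have J_next: "J s3"
      if "unread s3 = flatten rest" "var s3 Cnt = length rest" "graph (Suc (Suc K)) E' s3"
        "var s3 Arc = Suc (Suc K)" "mate_valid E' (arr s3 Mate)" "mate_maximal E' (arr s3 Mate)"
        "arr s3 Done = (\<lambda>_. 0)" "printed s3 = []" "clock s3 \<le> clock s' + 40" for s3 :: state
      unfolding J_def using that K E' *(2,12) rest'
      by (intro exI[of _ rest] exI[of _ E']) auto
    define tail where "tail =
      Get Va Mate Vu ;; Get Vb Mate Vv ;; Plus Va Va Vb ;;
      Cond Va Skip (Put Mate Vu Vv ;; Put Mate Vv Vu) ;; Minus Cnt Cnt One"
    have tail: "wp T B tail J s2"
      if s2: "graph (Suc (Suc K)) E' s2" "var s2 Arc = Suc (Suc K)" "var s2 Vu = u" "var s2 Vv = v"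
        "var s2 Cnt = length rest'" "arr s2 Mate = arr s' Mate" "arr s2 Done = (\<lambda>_. 0)"
        "unread s2 = flatten rest" "printed s2 = []" "clock s2 \<le> clock s' + 20" for s2 :: state
    proof -
      have zo: "var s2 One = 1"
        using s2(1) by (simp add: graph_def)
      \<comment> \<open>The sum of both partners is 0 iff both endpoints are unmatched; computing it
        requires the value bound \<open>2 * n\<close>.\<close>
      have le: "arr s' Mate u + arr s' Mate v \<le> B"
        using mate_le[of u] mate_le[of v] B(1) by linarith
      show ?thesis
      proof (cases "arr s' Mate u = 0 \<and> arr s' Mate v = 0")
        case True
        then have mv: "mate_valid E' ((arr s' Mate)(u := v, v := u))"
          using greedy_add[OF *(8,6)] uv by (simp add: E'_def)
        have mm: "mate_maximal E' ((arr s' Mate)(u := v, v := u))"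
          unfolding E'_def
        proof (rule mate_maximal_insert)
          show "mate_maximal E ((arr s' Mate)(u := v, v := u))"
            using uv by (intro mate_maximal_mono[OF *(9)]) (simp split: if_splits)
        qed (use uv in simp)
        show ?thesis
        proof (simp add: tail_def s2(3,4,6) True zo, rule J_next)
        qed (use s2(1,2,5,7-10) rest' mv mm in \<open>simp_all add: graph_def\<close>)
      next
        case False
        then have mm: "mate_maximal E' (arr s' Mate)"
          using mate_maximal_insert[OF *(9)] by (simp add: E'_def)
        have mv: "mate_valid E' (arr s' Mate)"
          by (rule mate_valid_mono[OF *(8)]) (auto simp: E'_def)
        have pos: "0 < arr s' Mate u + arr s' Mate v"
          using False by simp
        show ?thesis
        proof (simp add: tail_def s2(3,4,6) zo le pos del: add_gr_0, rule J_next)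
        qed (use s2(1,2,5-10) rest' mv mm in \<open>simp_all add: graph_def\<close>)
      qed
    qed
    \<comment> \<open>The five ticks are the loop test, two inputs and two increments; the
      increments shift agents to positive vertices.\<close>
    define s1 where "s1 = s'\<lparr>unread := flatten rest, var := (var s')(Vu := u, Vv := v),
      clock := Suc (Suc (Suc (Suc (Suc (clock s')))))\<rparr>"
    have g1: "graph K E s1"
      using *(4) by (simp add: graph_def s1_def K_def)
    have s1: "var s1 Arc = K" "var s1 Vu = u" "var s1 Vv = v" "clock s1 = clock s' + 5"
      "unread s1 = flatten rest" "arr s1 = arr s'" "var s1 Cnt = length rest'" "printed s1 = []"
      by (simp_all add: s1_def K_def *(3,11))
    have "wp T B (push Vu Vv) (wp T B (push Vv Vu) (wp T B tail J)) s1"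
    proof (rule wp_push[OF g1 s1(1)])
      fix s2 :: state
      assume 2: "graph (Suc K) (insert (var s1 Vu, var s1 Vv) E) s2" "var s2 Arc = Suc K"
        "\<And>z. z \<notin> {Arc, Tmp} \<Longrightarrow> var s2 z = var s1 z" "arr s2 Mate = arr s1 Mate"
        "arr s2 Done = arr s1 Done" "unread s2 = unread s1" "printed s2 = printed s1"
        "clock s2 = clock s1 + 6"
      show "wp T B (push Vv Vu) (wp T B tail J) s2"
      proof (rule wp_push[OF 2(1,2)])
        fix s3 :: state
        assume 3: "graph (Suc (Suc K)) (insert (var s2 Vv, var s2 Vu) (insert (var s1 Vu, var s1 Vv) E)) s3"
          "var s3 Arc = Suc (Suc K)"
          "\<And>z. z \<notin> {Arc, Tmp} \<Longrightarrow> var s3 z = var s2 z" "arr s3 Mate = arr s2 Mate"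
          "arr s3 Done = arr s2 Done" "unread s3 = unread s2" "printed s3 = printed s2"
          "clock s3 = clock s2 + 6"
        show "wp T B tail J s3"
          using 2 3 s1 *(10) by (intro tail) (simp_all add: E'_def)
      qed (use K B in simp_all)
    qed (use K B in simp_all)
    then show "wp T B
        (Input Vu ;; Plus Vu Vu One ;; Input Vv ;; Plus Vv Vv One ;;
         push Vu Vv ;; push Vv Vu ;; Get Va Mate Vu ;; Get Vb Mate Vv ;; Plus Va Va Vb ;;
         Cond Va Skip (Put Mate Vu Vv ;; Put Mate Vv Vu) ;; Minus Cnt Cnt One) J (tick s')"
      unfolding tail_def[symmetric] wp_Seq
      using xy B(1) *(1) one rest'
      by (simp add: flatten_def s1_def u_def v_def)
  qed
qed

section \<open>The main theorem\<close>

text \<open>This returns from shifted vertices to agents: \<open>mate_maximal\<close> rules out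
  augmenting paths of length 1, and \<open>unimprovable\<close> on all matched edges those of length
  3.\<close>

lemma k_stable_matched_edges:
  assumes I: "roommates I" and ties: "single_ties I" and k: "k > real (num_agents I) / 3"
    and E: "simple_arcs n E" "\<And>a b. (Suc a, Suc b) \<in> E \<longleftrightarrow> {a, b} \<in> edges I"
    and valid: "mate_valid E mate" and max: "mate_maximal E mate"
    and unimp: "\<And>u. mate u \<noteq> 0 \<Longrightarrow> unimprovable E mate u (mate u)"
  shows "k_stable I k (matched_edges mate)"
proof (rule k_stable_if_no_short_augmenting_path[OF I ties _ _ _ k])
  let ?M = "matched_edges mate"
  note mem = matched_edges_iff[OF valid E(1)]
  have rep: "\<exists>a b. e = {a, b} \<and> mate (Suc a) = Suc b" if e: "e \<in> ?M" for e
  proof -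
    obtain u where u: "mate u \<noteq> 0" "e = {u - 1, mate u - 1}"
      using e unfolding matched_edges_def by blast
    then have "mate (Suc (u - 1)) = Suc (mate u - 1)"
      using mate_valid_pos(1)[OF valid E(1) u(1)] by simp
    with u(2) show ?thesis by blast
  qed
  have free: "a \<notin> \<Union>?M \<longleftrightarrow> mate (Suc a) = 0" for a
  proof
    assume *: "a \<notin> \<Union>?M"
    show "mate (Suc a) = 0"
    proof (rule ccontr)
      assume "mate (Suc a) \<noteq> 0"
      then obtain b where "mate (Suc a) = Suc b"
        by (cases "mate (Suc a)") auto
      then show False
        using mem * by blast
    qed
  next
    assume *: "mate (Suc a) = 0"
    show "a \<notin> \<Union>?M"
    proof
      assume "a \<in> \<Union>?M"
      then obtain b c where bc: "a \<in> {b, c}" "mate (Suc b) = Suc c"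
        using rep by blast
      then have "mate (Suc c) = Suc b"
        using mate_valid_pos(5)[OF valid E(1), of "Suc b"] by simp
      with bc * show False by auto
    qed
  qed
  show "matching I ?M"
    unfolding matching_def
  proof (intro conjI subsetI pairwiseI)
    fix e assume "e \<in> ?M"
    then obtain a b where "e = {a, b}" "mate (Suc a) = Suc b"
      using rep by blast
    then have "(Suc a, Suc b) \<in> E"
      using valid unfolding mate_valid_def by (metis nat.simps(3))
    with \<open>e = {a, b}\<close> show "e \<in> edges I"
      using E(2) by simp
  next
    fix e f assume e: "e \<in> ?M" and f: "f \<in> ?M" and "e \<noteq> f"
    \<comment> \<open>A matched edge is determined by any one of its vertices, so distinct ones
      cannot meet.\<close>
    have eq: "e = {a, mate (Suc a) - 1}" if "e \<in> ?M" "a \<in> e" for a e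
    proof -
      obtain b c where bc: "e = {b, c}" "mate (Suc b) = Suc c"
        using rep \<open>e \<in> ?M\<close> by blast
      then have "mate (Suc c) = Suc b"
        using mate_valid_pos(5)[OF valid E(1), of "Suc b"] by simp
      with bc \<open>a \<in> e\<close> show ?thesis by auto
    qed
    show "disjnt e f"
    proof (rule ccontr)
      assume "\<not> disjnt e f"
      then obtain a where "a \<in> e" "a \<in> f"
        unfolding disjnt_def by blast
      with eq[OF e] eq[OF f] \<open>e \<noteq> f\<close> show False
        by metis
    qed
  qed
  show "i \<in> \<Union>?M \<or> j \<in> \<Union>?M" if "{i, j} \<in> edges I" for i j
  proof -
    have "(Suc i, Suc j) \<in> E"
      using that E(2) by simp
    then have "mate (Suc i) \<noteq> 0 \<or> mate (Suc j) \<noteq> 0"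
      using max unfolding mate_maximal_def by blast
    then show ?thesis
      using free[of i] free[of j] by argo
  qed
  show "a = b"
    if "{u, v} \<in> ?M" "{a, u} \<in> edges I" "{b, v} \<in> edges I" "a \<notin> \<Union>?M" "b \<notin> \<Union>?M" for u v a b
  proof -
    have "mate (Suc u) = Suc v"
      using that(1) mem by simp
    then have "unimprovable E mate (Suc u) (Suc v)"
      using unimp[of "Suc u"] by simp
    moreover have "(Suc u, Suc a) \<in> E" "(Suc v, Suc b) \<in> E"
      using that(2,3) E(2) by (simp_all add: insert_commute)
    ultimately show ?thesis
      using that(4,5) free unfolding unimprovable_def by blast
  qed
qed

definition program :: com where
  "program = Assign One 1 ;; Input Va ;; Input Cnt ;; read_edges ;; improve ;; print_matching"

text \<open>Initialisation takes 3 ticks, reading \<open>40 * m + 1\<close>, and with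
  \<open>2 * m\<close> arcs improving takes \<open>248 * m + 2\<close> and printing
  \<open>40 * m + 1\<close>, together \<open>328 * m + 7\<close>. The value bound has room for sums
  of two vertices, for arc indices up to \<open>2 * m\<close> and for two marks.\<close>

lemma wp_program:
  assumes I: "roommates I" "single_ties I" and k: "k > real (num_agents I) / 3"
    and enc: "encodes_instance xs I"
  defines "n \<equiv> num_agents I" and "m \<equiv> num_edges I"
  shows "wp (330 * m + 20) (2 * n + 2 * m + 2) program
    (\<lambda>s. clock s \<le> 330 * m + 20 \<and> (\<exists>M. k_stable I k M \<and> encodes_matching (printed s) M))
    (initial_state xs)"
    (is "wp ?T ?B program ?Q _")
proof -
  obtain es where agents: "agents I = {..<n}" and list: "edge_listing es (edges I)"
    and xs: "xs = n # m # flatten es"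
    using enc unfolding encodes_instance_def n_def m_def by blast
  have len: "length es = m" and img: "(\<lambda>(u, v). {u, v}) ` set es = edges I"
    using list by (auto simp: edge_listing_def m_def)
  have es: "\<forall>(u, v) \<in> set es. u < n \<and> v < n \<and> u \<noteq> v"
  proof (clarify, intro conjI)
    fix u v assume "(u, v) \<in> set es"
    then have "{u, v} \<in> edges I"
      using img by force
    then show "u < n" "v < n" "u \<noteq> v"
      using edge_endpoints[OF I(1)] agents by auto
  qed
  have arcs: "(Suc a, Suc b) \<in> arcs_of es \<longleftrightarrow> {a, b} \<in> edges I" for a b
    unfolding img[symmetric] arcs_of_def by (force simp: doubleton_eq_iff)
  define s0 where "s0 = (initial_state xs)\<lparr>unread := flatten es,
    var := (\<lambda>_. 0)(One := 1, Va := n, Cnt := m), clock := 3\<rparr>"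
  have "wp ?T ?B read_edges (wp ?T ?B improve (wp ?T ?B print_matching ?Q)) s0"
  proof (rule wp_read_edges[where es = es and n = n])
    fix s1 :: state
    assume 1: "graph (2 * length es) (arcs_of es) s1" "var s1 Arc = 2 * length es"
      and simple: "simple_arcs n (arcs_of es)"
      and m1: "mate_valid (arcs_of es) (arr s1 Mate)" "mate_maximal (arcs_of es) (arr s1 Mate)"
      "arr s1 Done = (\<lambda>_. 0)" "printed s1 = []" "clock s1 \<le> clock s0 + 40 * length es + 1"
    have c1: "clock s1 \<le> 4 + 40 * m"
      using m1(5) len by (simp add: s0_def)
    show "wp ?T ?B improve (wp ?T ?B print_matching ?Q) s1"
    proof (rule wp_improve[OF 1 m1(4,1,2,3) simple])
      fix s2 :: state
      assume 2: "graph (2 * length es) (arcs_of es) s2" "var s2 Arc = 2 * length es"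
        "printed s2 = []" "mate_valid (arcs_of es) (arr s2 Mate)"
        and max: "mate_maximal (arcs_of es) (arr s2 Mate)"
        and unimp: "\<And>u. arr s2 Mate u \<noteq> 0 \<Longrightarrow>
          unimprovable (arcs_of es) (arr s2 Mate) u (arr s2 Mate u)"
        and "clock s2 \<le> clock s1 + 124 * (2 * length es) + 2"
      then have c2: "clock s2 \<le> 6 + 288 * m"
        using c1 len by simp
      have stable: "k_stable I k (matched_edges (arr s2 Mate))"
        using k_stable_matched_edges[OF I k simple arcs 2(4) max unimp] .
      show "wp ?T ?B print_matching ?Q s2"
      proof (rule wp_print_matching[OF 2 simple])
        fix s3 :: state and L
        assume "printed s3 = flatten L" "edge_listing L (matched_edges (arr s2 Mate))"
          "clock s3 \<le> clock s2 + 20 * (2 * length es) + 1"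
        then show "?Q s3"
          using c2 len stable unfolding encodes_matching_def by auto
      qed (use c2 len in simp_all)
    qed (use c1 len in simp_all)
  qed (use es len in \<open>simp_all add: s0_def initial_state_def\<close>)
  then show ?thesis
    by (simp add: program_def wp_Seq initial_state_def s0_def xs numeral_3_eq_3)
qed

lemma computes_within_mono:
  "computes_within P xs T w ys \<Longrightarrow> T \<le> T' \<Longrightarrow> w \<le> w' \<Longrightarrow> computes_within P xs T' w' ys"
  unfolding computes_within_def by (blast intro: order_trans)

lemma stable_matching_findable:
  assumes "c > 1 / 3"
  shows "findable_in_time (\<lambda>I. roommates I \<and> single_ties I)
    (\<lambda>I. k_stable I (c * real (num_agents I))) (\<lambda>n m. sqrt (real n) * real m)"
  unfolding findable_in_time_def
\<comment> \<open>Six steps per tick turn \<open>330 * m + 20\<close> into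
  \<open>1980 * m + 120\<close>, and 2100 is the sum of these coefficients. The exponent 8 comes
  from a quadratic bound with factor \<open>64 = 2 ^ 6\<close>, the base \<open>n + 2\<close> being
  at least 2.\<close>
proof (rule exI[of _ "compile 0 program"], rule exI[of _ 2100], rule exI[of _ 8],
    intro allI impI, elim conjE)
  fix I :: "nat roommates_instance" and xs
  assume I: "roommates I" "single_ties I" and enc: "encodes_instance xs I"
  define n where "n = num_agents I"
  define m where "m = num_edges I"
  have "n > 0"
    using I(1) unfolding roommates_def n_def by (simp add: card_gt_0_iff)
  then have "real n / 3 < c * real n"
    using assms by simp
  then have "c * real (num_agents I) > real (num_agents I) / 3"
    by (simp add: n_def)
  from wp_computes_within[OF wp_program[OF I this enc]]
  obtain s :: state and M where s: "clock s \<le> 330 * m + 20" "k_stable I (c * real (num_agents I)) M"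
    "encodes_matching (printed s) M"
    and comp: "computes_within (compile 0 program) xs (6 * real (clock s))
      (8 * (2 * n + 2 * m + 2) + 24) (printed s)"
    unfolding n_def m_def by blast
  have "real m \<le> sqrt (real n) * real m"
    using \<open>n > 0\<close> by (intro mult_right_mono[of 1 "sqrt (real n)" "real m", simplified]) auto
  then have "real m \<le> max 1 (sqrt (real n) * real m)"
    by simp
  moreover have "6 * real (clock s) \<le> 1980 * real m + 120"
    using s(1) by linarith
  ultimately have time: "6 * real (clock s) \<le> 2100 * max 1 (sqrt (real n) * real m)"
    by linarith
  \<comment> \<open>The word size may depend on \<open>n\<close> only, so \<open>m\<close> is
    replaced by its quadratic bound.\<close>
  have "m \<le> n * n"
    using finite_edges(2)[OF I(1)] by (simp add: n_def m_def)
  then have "8 * (2 * n + 2 * m + 2) + 24 \<le> 64 * (n + 2) ^ 2"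
    by (simp add: power2_eq_square algebra_simps)
  also have "\<dots> = 2 ^ 6 * (n + 2) ^ 2"
    by simp
  also have "\<dots> \<le> (n + 2) ^ 6 * (n + 2) ^ 2"
    by (intro mult_right_mono power_mono) simp_all
  also have "\<dots> = (n + 2) ^ 8"
    by (simp flip: power_add)
  finally have words: "8 * (2 * n + 2 * m + 2) + 24 \<le> (n + 2) ^ 8" .
  show "\<exists>M ys. k_stable I (c * real (num_agents I)) M \<and> encodes_matching ys M \<and>
      computes_within (compile 0 program) xs
        (2100 * max 1 (sqrt (real (num_agents I)) * real (num_edges I))) ((num_agents I + 2) ^ 8) ys"
    using s(2,3) computes_within_mono[OF comp time words] unfolding n_def m_def by blast
qed

theorem theorem12:
  fixes c :: real
  assumes "c > 1 / 3"
  shows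
    "(\<forall>I :: 'a roommates_instance. roommates I \<and> single_ties I \<longrightarrow>
        (\<exists>M. k_stable I (c * real (num_agents I)) M)) \<and>
     findable_in_time (\<lambda>I. roommates I \<and> single_ties I)
       (\<lambda>I. k_stable I (c * real (num_agents I)))
       (\<lambda>n m. sqrt (real n) * real m) \<and>
     (\<forall>I :: 'a roommates_instance. marriage I \<and> single_ties I \<longrightarrow>
        (\<exists>M. k_stable I (c * real (num_agents I)) M)) \<and>
     findable_in_time (\<lambda>I. marriage I \<and> single_ties I)
       (\<lambda>I. k_stable I (c * real (num_agents I)))
       (\<lambda>n m. sqrt (real n) * real m)"
proof -
  \<comment> \<open>\<open>roommates\<close> includes that there is an agent; this makes
    \<open>c * n\<close> strictly larger than \<open>n / 3\<close>.\<close>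
  have exists: "\<exists>M. k_stable I (c * real (num_agents I)) M"
    if "roommates I" "single_ties I" for I :: "'a roommates_instance"
  proof -
    have "num_agents I > 0"
      using that(1) unfolding roommates_def by (simp add: card_gt_0_iff)
    then show ?thesis
      using assms by (intro k_stable_exists that) simp
  qed
  \<comment> \<open>Restricting the class of instances keeps the program and its constants.\<close>
  have "findable_in_time (\<lambda>I. marriage I \<and> single_ties I)
      (\<lambda>I. k_stable I (c * real (num_agents I))) (\<lambda>n m. sqrt (real n) * real m)"
    using stable_matching_findable[OF assms] unfolding findable_in_time_def marriage_def by meson
  then show ?thesis
    using exists stable_matching_findable[OF assms] unfolding marriage_def by blast
qed

end
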